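(* Let $S$ be a self-adjoint subspace in $X^2$, and let $A$ and $S+A$ be closed Hermitian subspaces in $X^2$, with $D(S)\subset D(A)$. Let $Q:A(0)^\perp\to S(0)^\perp$ be the orthogonal projection. If $QA_s$ is $S_s$-compact, then $\sigma_e(S)=\sigma_e(S+A)$; consequently $\sigma_e(S)=\emptyset$ if and only if $\sigma_e(S+A)=\emptyset$.
   Context: $X$ is a complex Hilbert space and $X^2=X\times X$ carries the inner product $\langle (x,f),(y,g)\rangle=\langle x,y\rangle+\langle f,g\rangle$. A subspace $T$ in $X^2$ means a linear subspace of $X^2$ (a linear relation); a linear operator in $X$ is identified with its graph. Notation: $D(T)=\{x:(x,f)\in T \text{ for some } f\}$, $T(x)=\{f:(x,f)\in T\}$, $T^{-1}=\{(f,x):(x,f)\in T\}$, $\lambda I$ is the graph of $x\mapsto\lambda x$. The adjoint is $T^*=\{(y,g)\in X^2:\langle g,x\rangle=\langle y,f\rangle \text{ for all }(x,f)\in T\}$; $T$ is Hermitian if $T\subset T^*$ and self-adjoint if $T=T^*$. For subspaces $S,A$ in $X^2$, $S+A=\{(x,f+g):(x,f)\in S,(x,g)\in A\}$. For a closed subspace $T$, set $T_\infty=\{(0,g)\in X^2:(0,g)\in T\}$ and $T_s=T\ominus T_\infty$ (orthogonal complement of $T_\infty$ in $T$), so $T=T_s\oplus T_\infty$; $T_s$ is the graph of a linear operator (the operator part of $T$) with $D(T_s)=D(T)$ and $R(T_s)\subset T(0)^\perp$. For linear operators $U,V$ in $X$ with $D(V)\subset D(U)$: $U$ is $V$-compact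 if $U|_{D(V)}$ is compact as a map from $(D(V),\|\cdot\|_V)$ into $X$, where $\|x\|_V=\|x\|+\|Vx\|$. Resolvent set: $\rho(T)=\{\lambda\in\mathbb C:(\lambda I-T)^{-1}$ is a bounded linear operator defined on all of $X\}$; spectrum $\sigma(T)=\mathbb C\setminus\rho(T)$. A number $\lambda$ is an eigenvalue of $T$ if $(x,\lambda x)\in T$ for some $x\ne 0$, with multiplicity the dimension of $\{x:(x,\lambda x)\in T\}$. The essential spectrum $\sigma_e(T)$ is the set of points of $\sigma(T)$ that are either accumulation points of $\sigma(T)$ or isolated eigenvalues of infinite multiplicity. *)

theory Defs
  imports "HOL-Analysis.Analysis"
begin

class complex_vector = real_vector +
  fixes scaleC :: "complex \<Rightarrow> 'a \<Rightarrow> 'a" (infixr \<open>*\<^sub>C\<close> 75)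
  assumes scaleC_add_right: "a *\<^sub>C (x + y) = a *\<^sub>C x + a *\<^sub>C y"
    and scaleC_add_left: "(a + b) *\<^sub>C x = a *\<^sub>C x + b *\<^sub>C x"
    and scaleC_scaleC: "a *\<^sub>C (b *\<^sub>C x) = (a * b) *\<^sub>C x"
    and scaleC_one: "1 *\<^sub>C x = x"
    and scaleR_scaleC: "scaleR r = scaleC (complex_of_real r)"

class complex_inner = complex_vector + real_normed_vector +
  fixes cinner :: "'a \<Rightarrow> 'a \<Rightarrow> complex"
  assumes cinner_commute: "cinner x y = cnj (cinner y x)"
    and cinner_add_left: "cinner (x + y) z = cinner x z + cinner y z"
    and cinner_scaleC_left: "cinner (r *\<^sub>C x) y = r * cinner x y"
    and cinner_self_nonneg: "0 \<le> Re (cinner x x)"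
    and cinner_eq_zero_iff: "cinner x x = 0 \<longleftrightarrow> x = 0"
    and norm_eq_sqrt_cinner: "norm x = sqrt (Re (cinner x x))"

class chilbert = complex_inner + complete_space

definition lin_rel :: "('a::complex_vector \<times> 'a) set \<Rightarrow> bool" where
  "lin_rel T \<longleftrightarrow> (0, 0) \<in> T
     \<and> (\<forall>x f y g. (x, f) \<in> T \<and> (y, g) \<in> T \<longrightarrow> (x + y, f + g) \<in> T)
     \<and> (\<forall>c x f. (x, f) \<in> T \<longrightarrow> (c *\<^sub>C x, c *\<^sub>C f) \<in> T)"

definition pinner :: "('a::complex_inner \<times> 'a) \<Rightarrow> ('a \<times> 'a) \<Rightarrow> complex" where
  "pinner p q = cinner (fst p) (fst q) + cinner (snd p) (snd q)"

definition rdom :: "('a \<times> 'a) set \<Rightarrow> 'a set" where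
  "rdom T = {x. \<exists>f. (x, f) \<in> T}"

definition rapp :: "('a \<times> 'a) set \<Rightarrow> 'a \<Rightarrow> 'a set" where
  "rapp T x = {f. (x, f) \<in> T}"

definition rinv :: "('a \<times> 'a) set \<Rightarrow> ('a \<times> 'a) set" where
  "rinv T = {(f, x) | x f. (x, f) \<in> T}"

definition radj :: "('a::complex_inner \<times> 'a) set \<Rightarrow> ('a \<times> 'a) set" where
  "radj T = {(y, g). \<forall>x f. (x, f) \<in> T \<longrightarrow> cinner g x = cinner y f}"

definition hermitian :: "('a::complex_inner \<times> 'a) set \<Rightarrow> bool" where
  "hermitian T \<longleftrightarrow> T \<subseteq> radj T"

definition self_adjoint :: "('a::complex_inner \<times> 'a) set \<Rightarrow> bool" where
  "self_adjoint T \<longleftrightarrow> T = radj T"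

definition rsum :: "('a::ab_group_add \<times> 'a) set \<Rightarrow> ('a \<times> 'a) set \<Rightarrow> ('a \<times> 'a) set" where
  "rsum S A = {(x, f + g) | x f g. (x, f) \<in> S \<and> (x, g) \<in> A}"

definition orth :: "'a::complex_inner set \<Rightarrow> 'a set" where
  "orth M = {y. \<forall>x\<in>M. cinner x y = 0}"

definition cproj :: "'a::complex_inner set \<Rightarrow> 'a \<Rightarrow> 'a" where
  "cproj M x = (THE y. y \<in> M \<and> x - y \<in> orth M)"

definition rel_inf :: "('a::complex_inner \<times> 'a) set \<Rightarrow> ('a \<times> 'a) set" where
  "rel_inf T = {(0, g) | g. (0, g) \<in> T}"

definition rel_s :: "('a::complex_inner \<times> 'a) set \<Rightarrow> ('a \<times> 'a) set" where
  "rel_s T = {p \<in> T. \<forall>q \<in> rel_inf T. pinner p q = 0}"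

definition rcomp_map :: "('a \<Rightarrow> 'a) \<Rightarrow> ('a \<times> 'a) set \<Rightarrow> ('a \<times> 'a) set" where
  "rcomp_map P U = {(x, P f) | x f. (x, f) \<in> U}"

definition rel_compact :: "('a::complex_inner \<times> 'a) set \<Rightarrow> ('a \<times> 'a) set \<Rightarrow> bool" where
  "rel_compact U V \<longleftrightarrow> rdom V \<subseteq> rdom U \<and>
     (\<forall>B. B \<subseteq> rdom V \<and> (\<exists>C. \<forall>x\<in>B. \<forall>f. (x, f) \<in> V \<longrightarrow> norm x + norm f \<le> C)
        \<longrightarrow> compact (closure {f. \<exists>x\<in>B. (x, f) \<in> U}))"

definition lam_minus :: "complex \<Rightarrow> ('a::complex_vector \<times> 'a) set \<Rightarrow> ('a \<times> 'a) set" where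
  "lam_minus lam T = {(x, lam *\<^sub>C x - f) | x f. (x, f) \<in> T}"

definition bounded_everywhere_op :: "('a::complex_inner \<times> 'a) set \<Rightarrow> bool" where
  "bounded_everywhere_op R \<longleftrightarrow> lin_rel R
     \<and> (\<forall>y x x'. (y, x) \<in> R \<and> (y, x') \<in> R \<longrightarrow> x = x')
     \<and> rdom R = UNIV
     \<and> (\<exists>C. \<forall>y x. (y, x) \<in> R \<longrightarrow> norm x \<le> C * norm y)"

definition resolvent_set :: "('a::complex_inner \<times> 'a) set \<Rightarrow> complex set" where
  "resolvent_set T = {lam. bounded_everywhere_op (rinv (lam_minus lam T))}"

definition rspectrum :: "('a::complex_inner \<times> 'a) set \<Rightarrow> complex set" where
  "rspectrum T = UNIV - resolvent_set T"

definition eigenspace :: "('a::complex_vector \<times> 'a) set \<Rightarrow> complex \<Rightarrow> 'a set" where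
  "eigenspace T lam = {x. (x, lam *\<^sub>C x) \<in> T}"

definition is_eigenvalue :: "('a::complex_vector \<times> 'a) set \<Rightarrow> complex \<Rightarrow> bool" where
  "is_eigenvalue T lam \<longleftrightarrow> (\<exists>x. x \<noteq> 0 \<and> (x, lam *\<^sub>C x) \<in> T)"

definition cfin_dim :: "'a::complex_vector set \<Rightarrow> bool" where
  "cfin_dim E \<longleftrightarrow> (\<exists>F. finite F \<and> E \<subseteq> module.span (scaleC :: complex \<Rightarrow> 'a \<Rightarrow> 'a) F)"

definition ess_spectrum :: "('a::complex_inner \<times> 'a) set \<Rightarrow> complex set" where
  "ess_spectrum T = {lam \<in> rspectrum T.
      lam islimpt rspectrum T
    \<or> (\<not> lam islimpt rspectrum T \<and> is_eigenvalue T lam \<and> \<not> cfin_dim (eigenspace T lam))}"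

end

theory Submission
  imports Defs
begin

text \<open>
  Since \<open>A\<close> is Hermitian and \<open>D(S) \<subseteq> D(A)\<close>, \<open>A(0) \<subseteq> S(0)\<close>; hence \<open>S + A\<close> consists of the pairs
  \<open>(x, f + K x)\<close> with \<open>(x, f) \<in> S\<close>, where \<open>K = Q A\<^sub>s\<close> is symmetric on \<open>D(S)\<close>, maps into
  \<open>S(0)\<^sup>\<bottom>\<close> and is relatively compact. Relative compactness and symmetry give \<open>K\<close> relative bound 0,
  so \<open>S + A\<close> is self-adjoint (Kato-Rellich). For a self-adjoint relation \<open>T\<close> the essential
  spectrum is the set of \<open>\<mu>\<close> with a singular sequence: unit vectors \<open>x\<^sub>n\<close>, weakly null, with
  \<open>(T - \<mu>) x\<^sub>n \<rightarrow> 0\<close>. Along such a sequence \<open>K x\<^sub>n\<close> subconverges, by symmetry to 0, so \<open>S\<close> and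
  \<open>S + A\<close> have the same singular sequences up to subsequences.

  The characterisation by singular sequences is obtained without the spectral theorem. Its main point
  is that \<open>T - \<mu>\<close> is bounded below on the complement of its kernel when \<open>\<mu>\<close> is isolated in the
  spectrum; this follows from the norm of the resolvents at the midpoints of the two adjacent gaps.
\<close>

section \<open>Complex Hilbert spaces\<close>

text \<open>The inclusion of \<open>A(0)\<close> in \<open>S(0)\<close> is a duality argument: for
  \<open>(0, a)\<close> in \<open>A\<close> and \<open>y\<close> in \<open>D(S)\<close>, hermiticity
  of \<open>A\<close> makes \<open>a\<close> orthogonal to \<open>y\<close>, so
  \<open>(0, a)\<close> lies in the adjoint of \<open>S\<close>, which is \<open>S\<close>. In the
  same way a vector orthogonal to both \<open>S(0)\<close> and \<open>D(S)\<close> vanishes. This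
  gives linearity of \<open>K\<close> and identifies limits of \<open>K x_n\<close> as 0. The
  obstacle is to turn isolation of a spectral point into an inequality. Heuristically, if 0 has
  distance \<open>e\<close> from the rest of the spectrum of \<open>L\<close>, each spectral value
  satisfies \<open>lambda^2 >= e * |lambda|\<close>. The quadratic version,
  \<open>e * |Re <h, x>| <= ||h||^2\<close> for \<open>(x, h)\<close> in \<open>L\<close>, comes
  from the lower bounds \<open>||h - r x|| >= (e/2) ||x||\<close> with \<open>r = e/2\<close> and
  \<open>r = -e/2\<close>: after squaring, the terms in \<open>||x||^2\<close> cancel. Only one
  inclusion of essential spectra is proved directly. The other is the same statement for
  \<open>S\<close> as a perturbation of \<open>S + A\<close> by \<open>-K\<close>; relative bound
  below 1 makes the graph norms comparable, so \<open>K\<close> is also compact relative to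
  \<open>S + A\<close>.\<close>

interpretation cvec: vector_space "scaleC :: complex \<Rightarrow> 'a \<Rightarrow> 'a::complex_vector"
  by unfold_locales (simp_all add: scaleC_add_right scaleC_add_left scaleC_scaleC scaleC_one)

lemma cinner_diff_left: "cinner (x - y) (z::'a::complex_inner) = cinner x z - cinner y z"
  using cinner_add_left[of "x - y" y z] by simp

lemma cinner_zero_left [simp]: "cinner 0 (z::'a::complex_inner) = 0"
  using cinner_diff_left[of 0 0 z] by simp

lemma cinner_zero_right [simp]: "cinner (z::'a::complex_inner) 0 = 0"
  using cinner_commute[of z 0] by simp

lemma cinner_add_right: "cinner (z::'a::complex_inner) (x + y) = cinner z x + cinner z y"
  using cinner_commute[of z] cinner_add_left by (metis complex_cnj_add)

lemma cinner_diff_right: "cinner (z::'a::complex_inner) (x - y) = cinner z x - cinner z y"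
  using cinner_commute[of z] cinner_diff_left by (metis complex_cnj_diff)

lemma cinner_scaleC_right: "cinner (z::'a::complex_inner) (c *\<^sub>C x) = cnj c * cinner z x"
  using cinner_commute[of z] cinner_scaleC_left by (metis complex_cnj_mult)

lemmas cinner_simps = cinner_diff_left cinner_diff_right cinner_add_left cinner_add_right
  cinner_scaleC_left cinner_scaleC_right

lemma cinner_sum_left: "cinner (\<Sum>i\<in>I. u i) (z::'a::complex_inner) = (\<Sum>i\<in>I. cinner (u i) z)"
  by (induction I rule: infinite_finite_induct) (simp_all add: cinner_add_left)

lemma cinner_self: "cinner x x = complex_of_real ((norm (x::'a::complex_inner))\<^sup>2)"
proof -
  have "Im (cinner x x) = 0"
    using arg_cong[OF cinner_commute[of x x], of Im] by simp
  then show ?thesis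
    by (simp add: complex_eq_iff norm_eq_sqrt_cinner cinner_self_nonneg)
qed

lemma norm_add_square:
  "(norm (x + y :: 'a::complex_inner))\<^sup>2 = (norm x)\<^sup>2 + 2 * Re (cinner x y) + (norm y)\<^sup>2"
proof -
  have "(norm (x + y))\<^sup>2 = Re (cinner (x + y) (x + y))"
    by (simp add: cinner_self)
  also have "\<dots> = Re (cinner x x) + Re (cinner x y) + Re (cinner y x) + Re (cinner y y)"
    by (simp add: cinner_add_left cinner_add_right)
  also have "Re (cinner y x) = Re (cinner x y)"
    by (subst cinner_commute) simp
  finally show ?thesis
    by (simp add: cinner_self)
qed

lemma norm_diff_square:
  "(norm (x - y :: 'a::complex_inner))\<^sup>2 = (norm x)\<^sup>2 - 2 * Re (cinner x y) + (norm y)\<^sup>2"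
proof -
  have "cinner x (- y) = - cinner x y"
    using cinner_diff_right[of x 0 y] by simp
  then show ?thesis
    using norm_add_square[of x "- y"] by simp
qed

lemma norm_scaleC: "norm (c *\<^sub>C (x::'a::complex_inner)) = cmod c * norm x"
proof -
  have "complex_of_real ((norm (c *\<^sub>C x))\<^sup>2) = (c * cnj c) * cinner x x"
    unfolding cinner_self[symmetric] by (simp add: cinner_scaleC_left cinner_scaleC_right)
  also have "\<dots> = complex_of_real ((cmod c * norm x)\<^sup>2)"
    by (simp only: complex_norm_square[symmetric] cinner_self of_real_mult[symmetric] power_mult_distrib)
  finally have "complex_of_real ((norm (c *\<^sub>C x))\<^sup>2) = complex_of_real ((cmod c * norm x)\<^sup>2)" .
  then have "(norm (c *\<^sub>C x))\<^sup>2 = (cmod c * norm x)\<^sup>2"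
    by (simp only: of_real_eq_iff)
  then show ?thesis
    by (simp add: power2_eq_iff_nonneg)
qed

lemma scaleC_of_real: "complex_of_real r *\<^sub>C (x::'a::complex_vector) = r *\<^sub>R x"
  by (simp add: scaleR_scaleC)

text \<open>Stated for an abstract form because it is also applied to a form on a linear relation.\<close>
lemma semi_inner_cauchy_schwarz:
  fixes a b :: real and c :: complex
  assumes nonneg: "\<And>t. 0 \<le> a - 2 * Re (cnj t * c) + (cmod t)\<^sup>2 * b" and "0 \<le> a" "0 \<le> b"
  shows "(cmod c)\<^sup>2 \<le> a * b"
proof (cases "b = 0")
  case True
  have "c = 0"
  proof (rule ccontr)
    assume "c \<noteq> 0"
    \<comment> \<open>With \<open>t = s * c\<close> the linear term is \<open>2 * (a + 1)\<close>,
      which exceeds \<open>a\<close>.\<close>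
    define s where "s = (a + 1) / (cmod c)\<^sup>2"
    have "cnj (complex_of_real s * c) * c = complex_of_real s * (c * cnj c)"
      by simp
    also have "\<dots> = complex_of_real (a + 1)"
      unfolding complex_norm_square[symmetric] of_real_mult[symmetric]
      using \<open>c \<noteq> 0\<close> by (simp add: s_def)
    finally have "cnj (complex_of_real s * c) * c = complex_of_real (a + 1)" .
    then have "Re (cnj (complex_of_real s * c) * c) = a + 1"
      by (simp only: Re_complex_of_real)
    then show False
      using nonneg[of "complex_of_real s * c"] True assms(2) by simp
  qed
  then show ?thesis
    using assms by simp
next
  case False
  then have "b > 0"
    using assms by simp
  have eq: "Re (cnj (c / complex_of_real b) * c) = (cmod c)\<^sup>2 / b"
    unfolding cmod_power2 by (simp add: power2_eq_square add_divide_distrib)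
  \<comment> \<open>For \<open>b > 0\<close> the quadratic is smallest at
    \<open>t = c / b\<close>.\<close>
  have "0 \<le> a - 2 * ((cmod c)\<^sup>2 / b) + (cmod c)\<^sup>2 / b\<^sup>2 * b"
    using nonneg[of "c / complex_of_real b"] unfolding eq using \<open>b > 0\<close> by (simp add: norm_divide power_divide)
  also have "\<dots> = a - (cmod c)\<^sup>2 / b"
    using \<open>b > 0\<close> by (simp add: field_simps power2_eq_square)
  finally show ?thesis
    using \<open>b > 0\<close> by (simp add: field_simps)
qed

lemma cinner_cauchy_schwarz: "cmod (cinner x y) \<le> norm x * norm (y::'a::complex_inner)"
proof -
  have "(cmod (cinner x y))\<^sup>2 \<le> (norm x)\<^sup>2 * (norm y)\<^sup>2"
  proof (rule semi_inner_cauchy_schwarz)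
    fix t
    have "0 \<le> (norm (x - t *\<^sub>C y))\<^sup>2"
      by simp
    then show "0 \<le> (norm x)\<^sup>2 - 2 * Re (cnj t * cinner x y) + (cmod t)\<^sup>2 * (norm y)\<^sup>2"
      unfolding norm_diff_square by (simp add: cinner_scaleC_right norm_scaleC power_mult_distrib)
  qed auto
  then show ?thesis
    by (simp add: power_mult_distrib[symmetric] power2_le_iff_abs_le)
qed

lemma tendsto_cinner_left:
  assumes "(u \<longlongrightarrow> l) F"
  shows "((\<lambda>n. cinner (u n) (w::'a::complex_inner)) \<longlongrightarrow> cinner l w) F"
proof (rule LIM_zero_cancel, rule Lim_null_comparison)
  show "\<forall>\<^sub>F n in F. norm (cinner (u n) w - cinner l w) \<le> norm (u n - l) * norm w"
    by (simp add: cinner_diff_left[symmetric] cinner_cauchy_schwarz)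
  show "((\<lambda>n. norm (u n - l) * norm w) \<longlongrightarrow> 0) F"
    using assms by (intro tendsto_mult_left_zero tendsto_norm_zero LIM_zero)
qed

lemma tendsto_scaleC:
  assumes "(u \<longlongrightarrow> (l::'a::complex_inner)) F"
  shows "((\<lambda>n. c *\<^sub>C u n) \<longlongrightarrow> c *\<^sub>C l) F"
proof -
  have "((\<lambda>n. norm (c *\<^sub>C u n - c *\<^sub>C l)) \<longlongrightarrow> 0) F"
    unfolding cvec.scale_right_diff_distrib[symmetric] norm_scaleC
    using assms by (intro tendsto_mult_right_zero tendsto_norm_zero LIM_zero)
  then show ?thesis
    by (rule LIM_zero_cancel[OF tendsto_norm_zero_cancel])
qed

lemma tendsto_of_bounded_by:
  fixes u :: "nat \<Rightarrow> 'a::real_normed_vector"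
  assumes "\<And>n. norm (u n) \<le> C * v n" "v \<longlonglongrightarrow> (0::real)"
  shows "u \<longlonglongrightarrow> 0"
proof (rule Lim_null_comparison)
  show "\<forall>\<^sub>F n in sequentially. norm (u n) \<le> C * v n"
    using assms(1) by simp
  show "(\<lambda>n. C * v n) \<longlonglongrightarrow> 0"
    using assms(2) by (rule tendsto_mult_right_zero)
qed

section \<open>Orthogonal complements and the projection theorem\<close>

lemma cinner_eq_zero_commute: "cinner x (y::'a::complex_inner) = 0 \<longleftrightarrow> cinner y x = 0"
  using cinner_commute[of x y] by simp

lemma in_orth_iff: "y \<in> orth M \<longleftrightarrow> (\<forall>x\<in>M. cinner y x = 0)"
  by (simp add: orth_def cinner_eq_zero_commute[of y])

lemma subspace_orth: "cvec.subspace (orth M)"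
  by (auto simp: cvec.subspace_def orth_def cinner_add_right cinner_scaleC_right)

lemma closed_orth: "closed (orth M)"
  unfolding closed_sequential_limits
proof (intro allI impI)
  fix u l assume *: "(\<forall>n. u n \<in> orth M) \<and> u \<longlonglongrightarrow> l"
  show "l \<in> orth M"
    unfolding in_orth_iff
  proof
    fix w assume "w \<in> M"
    then have "cinner (u n) w = 0" for n
      using * by (simp add: in_orth_iff)
    then have "(\<lambda>n. 0) \<longlonglongrightarrow> cinner l w"
      using tendsto_cinner_left[of u l sequentially w] * by simp
    then show "cinner l w = 0"
      using LIMSEQ_unique tendsto_const by blast
  qed
qed

lemma orth_closure: "orth (closure M) = orth M"
proof
  show "orth (closure M) \<subseteq> orth M"
    unfolding orth_def using closure_subset by blast
  show "orth M \<subseteq> orth (closure M)"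
  proof
    fix y assume "y \<in> orth M"
    then have "M \<subseteq> orth {y}"
      unfolding orth_def using cinner_eq_zero_commute by blast
    then have "closure M \<subseteq> orth {y}"
      by (rule closure_minimal[OF _ closed_orth])
    then show "y \<in> orth (closure M)"
      unfolding orth_def using cinner_eq_zero_commute by blast
  qed
qed

lemma orth_inter_self: "y \<in> M \<Longrightarrow> y \<in> orth M \<Longrightarrow> y = 0"
  by (auto simp: orth_def cinner_eq_zero_iff)

lemma subspace_closure:
  assumes "cvec.subspace (M :: 'a::complex_inner set)"
  shows "cvec.subspace (closure M)"
  unfolding cvec.subspace_def
proof (intro conjI allI ballI)
  show "0 \<in> closure M"
    using assms closure_subset cvec.subspace_0 by blast
next
  fix x y assume "x \<in> closure M" "y \<in> closure M"
  then obtain u v where "\<And>n. u n \<in> M" "u \<longlonglongrightarrow> x" "\<And>n. v n \<in> M" "v \<longlonglongrightarrow> y"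
    unfolding closure_sequential by blast
  then show "x + y \<in> closure M"
    unfolding closure_sequential
    using cvec.subspace_add[OF assms] tendsto_add[of u x sequentially v y]
    by (intro exI[of _ "\<lambda>n. u n + v n"]) simp
next
  fix c x assume "x \<in> closure M"
  then obtain u where "\<And>n. u n \<in> M" "u \<longlonglongrightarrow> x"
    unfolding closure_sequential by blast
  then show "c *\<^sub>C x \<in> closure M"
    unfolding closure_sequential
    using cvec.subspace_scale[OF assms] tendsto_scaleC[of u x sequentially c]
    by (intro exI[of _ "\<lambda>n. c *\<^sub>C u n"]) simp
qed

text \<open>The parallelogram law makes a minimising sequence Cauchy, and minimality of its limit
  along every complex line in \<open>M\<close> gives orthogonality.\<close>

lemma orth_projection_exists:
  fixes M :: "'a::chilbert set"
  assumes sub: "cvec.subspace M" and cl: "closed M"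
  obtains y where "y \<in> M" "x - y \<in> orth M"
proof -
  define d where "d = Inf ((\<lambda>m. norm (x - m)) ` M)"
  have ne: "M \<noteq> {}"
    using sub cvec.subspace_0 by blast
  have bb: "bdd_below ((\<lambda>m. norm (x - m)) ` M)"
    by (intro bdd_belowI2[of _ 0]) auto
  have d_le: "d \<le> norm (x - m)" if "m \<in> M" for m
    unfolding d_def using bb that by (rule cINF_lower)
  have d0: "0 \<le> d"
    unfolding d_def using ne by (intro cINF_greatest) auto
  have "\<exists>m\<in>M. norm (x - m) < d + 1 / real (Suc n)" for n
    using cInf_lessD[of "(\<lambda>m. norm (x - m)) ` M" "d + 1 / real (Suc n)"] ne
    by (auto simp: d_def[symmetric])
  then obtain u where uM: "\<And>n. u n \<in> M" and u: "\<And>n. norm (x - u n) < d + 1 / real (Suc n)"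
    by metis
  \<comment> \<open>The excess over the squared distance \<open>d\<^sup>2\<close>; squares, because
    the parallelogram law is applied to them.\<close>
  define e where "e = (\<lambda>n. (d + 1 / real (Suc n))\<^sup>2 - d\<^sup>2)"
  have "(\<lambda>n. 1 / real (Suc n)) \<longlonglongrightarrow> 0"
    by (rule LIMSEQ_Suc[OF lim_inverse_n'])
  then have "e \<longlonglongrightarrow> (d + 0)\<^sup>2 - d\<^sup>2"
    unfolding e_def by (intro tendsto_diff tendsto_power tendsto_add tendsto_const)
  then have e0: "e \<longlonglongrightarrow> 0"
    by simp
  have step: "(norm (u n - u m))\<^sup>2 \<le> 2 * e n + 2 * e m" for m n
  proof -
    have "(1 / 2) *\<^sub>R (u n + u m) = complex_of_real (1/2) *\<^sub>C (u n + u m)"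
      by (simp only: scaleC_of_real)
    then have "(1 / 2) *\<^sub>R (u n + u m) \<in> M"
      using cvec.subspace_scale[OF sub cvec.subspace_add[OF sub uM uM]] by simp
    then have "d \<le> norm (x - (1 / 2) *\<^sub>R (u n + u m))"
      by (rule d_le)
    moreover have "(x - u n) + (x - u m) = 2 *\<^sub>R (x - (1 / 2) *\<^sub>R (u n + u m))"
      by (simp add: scaleR_diff_right scaleR_2)
    then have "norm ((x - u n) + (x - u m)) = 2 * norm (x - (1 / 2) *\<^sub>R (u n + u m))"
      by simp
    ultimately have "2 * d \<le> norm ((x - u n) + (x - u m))"
      by simp
    then have 1: "(2 * d)\<^sup>2 \<le> (norm ((x - u n) + (x - u m)))\<^sup>2"
      using d0 by (intro power_mono) auto
    have 2: "(norm ((x - u n) + (x - u m)))\<^sup>2 + (norm ((x - u n) - (x - u m)))\<^sup>2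
        = 2 * (norm (x - u n))\<^sup>2 + 2 * (norm (x - u m))\<^sup>2"
      unfolding norm_add_square[of "x - u n"] norm_diff_square[of "x - u n"] by simp
    have 3: "(norm (x - u k))\<^sup>2 \<le> e k + d\<^sup>2" for k
      unfolding e_def using power_mono[OF less_imp_le[OF u[of k]], of 2] by simp
    have 4: "norm ((x - u n) - (x - u m)) = norm (u n - u m)"
      by (simp add: norm_minus_commute)
    show ?thesis
      using 1 2 3[of n] 3[of m] unfolding 4 power_mult_distrib by simp
  qed
  have "Cauchy u"
    unfolding Cauchy_iff
  proof (intro allI impI)
    fix \<epsilon> :: real assume "0 < \<epsilon>"
    then have "\<forall>\<^sub>F n in sequentially. e n < \<epsilon>\<^sup>2 / 4"
      using e0 by (intro order_tendstoD(2)[OF e0]) simp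
    then obtain N where N: "\<And>n. N \<le> n \<Longrightarrow> e n < \<epsilon>\<^sup>2 / 4"
      by (auto simp: eventually_sequentially)
    have "norm (u m - u n) < \<epsilon>" if "N \<le> m" "N \<le> n" for m n
    proof -
      have "(norm (u m - u n))\<^sup>2 < \<epsilon>\<^sup>2"
        using step[of m n] N[OF that(1)] N[OF that(2)] by simp
      then show ?thesis
        using \<open>0 < \<epsilon>\<close> by (simp add: power2_less_imp_less)
    qed
    then show "\<exists>N. \<forall>m\<ge>N. \<forall>n\<ge>N. norm (u m - u n) < \<epsilon>"
      by blast
  qed
  then obtain y where y: "u \<longlonglongrightarrow> y"
    using Cauchy_convergent convergent_def by blast
  have "y \<in> M"
    using cl uM y closed_sequential_limits by blast
  have nxy: "norm (x - y) \<le> d"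
  proof (rule LIMSEQ_le)
    show "(\<lambda>n. norm (x - u n)) \<longlonglongrightarrow> norm (x - y)"
      using y by (intro tendsto_intros)
    show "(\<lambda>n. d + 1 / real (Suc n)) \<longlonglongrightarrow> d"
      using tendsto_add[OF tendsto_const[of d] LIMSEQ_Suc[OF lim_inverse_n']] by simp
  qed (use u less_imp_le in blast)
  have "x - y \<in> orth M"
    unfolding in_orth_iff
  proof
    fix m assume "m \<in> M"
    show "cinner (x - y) m = 0"
    proof -
      \<comment> \<open>Minimality against \<open>y + t m\<close> is the hypothesis of the abstract
        Cauchy-Schwarz inequality with \<open>a = 0\<close>.\<close>
      have "0 \<le> 0 - 2 * Re (cnj t * cinner (x - y) m) + (cmod t)\<^sup>2 * (norm m)\<^sup>2" for t
      proof -
        have "y + t *\<^sub>C m \<in> M"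
          using \<open>y \<in> M\<close> \<open>m \<in> M\<close> sub cvec.subspace_add cvec.subspace_scale by blast
        then have "norm (x - y) \<le> norm ((x - y) - t *\<^sub>C m)"
          using d_le[of "y + t *\<^sub>C m"] nxy by (simp add: diff_diff_eq)
        then have "(norm (x - y))\<^sup>2 \<le> (norm ((x - y) - t *\<^sub>C m))\<^sup>2"
          by (intro power_mono) auto
        then show ?thesis
          unfolding norm_diff_square[of "x - y"]
          by (simp add: cinner_scaleC_right norm_scaleC power_mult_distrib)
      qed
      then have "(cmod (cinner (x - y) m))\<^sup>2 \<le> 0 * (norm m)\<^sup>2"
        by (rule semi_inner_cauchy_schwarz) auto
      then show ?thesis
        by simp
    qed
  qed
  with \<open>y \<in> M\<close> show ?thesis
    using that by blast
qed

section \<open>Self-adjoint relations and their resolvents\<close>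

lemma lin_rel_zero: "lin_rel T \<Longrightarrow> (0, 0) \<in> T"
  by (simp add: lin_rel_def)

lemma lin_rel_add: "lin_rel T \<Longrightarrow> (x, f) \<in> T \<Longrightarrow> (y, g) \<in> T \<Longrightarrow> (x + y, f + g) \<in> T"
  by (simp add: lin_rel_def)

lemma lin_rel_scale: "lin_rel T \<Longrightarrow> (x, f) \<in> T \<Longrightarrow> (c *\<^sub>C x, c *\<^sub>C f) \<in> T"
  by (simp add: lin_rel_def)

lemma lin_rel_diff:
  assumes "lin_rel T" "(x, f) \<in> T" "(y, g) \<in> T"
  shows "(x - y, f - g) \<in> T"
  using lin_rel_add[OF assms(1,2) lin_rel_scale[OF assms(1,3), of "- 1"]] by simp

lemma hermitian_cinner_eq:
  assumes "hermitian T" "(x, f) \<in> T" "(y, g) \<in> T"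
  shows "cinner g x = cinner y f"
  using assms by (auto simp: hermitian_def radj_def)

lemma self_adjoint_imp_hermitian: "self_adjoint T \<Longrightarrow> hermitian T"
  by (simp add: self_adjoint_def hermitian_def)

lemma self_adjoint_memI:
  assumes "self_adjoint T" "\<And>x f. (x, f) \<in> T \<Longrightarrow> cinner g x = cinner y f"
  shows "(y, g) \<in> T"
proof -
  have "(y, g) \<in> radj T"
    using assms(2) by (auto simp: radj_def)
  then show ?thesis
    using assms(1) by (simp add: self_adjoint_def)
qed

lemma self_adjoint_limit:
  assumes "self_adjoint T" "\<And>n::nat. (u n, v n) \<in> T" "u \<longlonglongrightarrow> y" "v \<longlonglongrightarrow> g"
  shows "(y, g) \<in> T"
proof (rule self_adjoint_memI[OF assms(1)])
  fix x f assume "(x, f) \<in> T"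
  then have "cinner (v n) x = cinner (u n) f" for n
    using hermitian_cinner_eq[OF self_adjoint_imp_hermitian[OF assms(1)]] assms(2) by blast
  then have "(\<lambda>n. cinner (u n) f) \<longlonglongrightarrow> cinner g x"
    using tendsto_cinner_left[OF assms(4), of x] by simp
  then show "cinner g x = cinner y f"
    using tendsto_cinner_left[OF assms(3), of f] LIMSEQ_unique by blast
qed

lemma hermitian_cinner_real:
  assumes "hermitian T" "(x, f) \<in> T"
  shows "Im (cinner f x) = 0"
  using hermitian_cinner_eq[OF assms assms(2)] cinner_commute[of f x]
  by (simp add: complex_eq_iff)

text \<open>\<open>cinner f x\<close> is real, so the imaginary part of
  \<open>cinner (f - \<mu> *\<^sub>C x) x\<close> comes from \<mu> alone.\<close>

lemma hermitian_nonreal_bound: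
  assumes "hermitian T" "(x, f) \<in> T"
  shows "\<bar>Im \<mu>\<bar> * norm x \<le> norm (f - \<mu> *\<^sub>C x)"
proof (cases "x = 0")
  case False
  have "Im (cinner (f - \<mu> *\<^sub>C x) x) = - Im \<mu> * (norm x)\<^sup>2"
    using hermitian_cinner_real[OF assms] by (simp add: cinner_simps cinner_self)
  then have "\<bar>Im \<mu>\<bar> * (norm x)\<^sup>2 \<le> norm (f - \<mu> *\<^sub>C x) * norm x"
    using abs_Im_le_cmod[of "cinner (f - \<mu> *\<^sub>C x) x"] cinner_cauchy_schwarz[of "f - \<mu> *\<^sub>C x" x]
    by (simp add: abs_mult)
  then show ?thesis
    using False by (simp add: power2_eq_square)
qed simp

text \<open>For self-adjoint relations this describes the resolvent set; all later spectral
  arguments work with such lower bounds instead of inverses.\<close>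

definition bounded_below_at :: "('a::complex_inner \<times> 'a) set \<Rightarrow> complex \<Rightarrow> bool" where
  "bounded_below_at T \<mu> \<longleftrightarrow> (\<exists>c>0. \<forall>x f. (x, f) \<in> T \<longrightarrow> c * norm x \<le> norm (f - \<mu> *\<^sub>C x))"

definition ran_minus :: "('a::complex_vector \<times> 'a) set \<Rightarrow> complex \<Rightarrow> 'a set" where
  "ran_minus T \<mu> = {f - \<mu> *\<^sub>C x | x f. (x, f) \<in> T}"

lemma ran_minusI: "(x, f) \<in> T \<Longrightarrow> f - \<mu> *\<^sub>C x \<in> ran_minus T \<mu>"
  by (auto simp: ran_minus_def)

lemma subspace_ran_minus:
  assumes "lin_rel T"
  shows "cvec.subspace (ran_minus T \<mu>)"
  unfolding cvec.subspace_def
proof (intro conjI ballI allI)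
  show "0 \<in> ran_minus T \<mu>"
    using ran_minusI[OF lin_rel_zero[OF assms], of \<mu>] by simp
next
  fix y z assume "y \<in> ran_minus T \<mu>" "z \<in> ran_minus T \<mu>"
  then obtain x f x' f' where "(x, f) \<in> T" "y = f - \<mu> *\<^sub>C x" "(x', f') \<in> T" "z = f' - \<mu> *\<^sub>C x'"
    by (auto simp: ran_minus_def)
  then show "y + z \<in> ran_minus T \<mu>"
    using ran_minusI[OF lin_rel_add[OF assms, of x f x' f'], of \<mu>]
    by (simp add: scaleC_add_right add_diff_add)
next
  fix c y assume "y \<in> ran_minus T \<mu>"
  then obtain x f where "(x, f) \<in> T" "y = f - \<mu> *\<^sub>C x"
    by (auto simp: ran_minus_def)
  then show "c *\<^sub>C y \<in> ran_minus T \<mu>"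
    using ran_minusI[OF lin_rel_scale[OF assms, of x f c], of \<mu>]
    by (simp add: cvec.scale_right_diff_distrib mult.commute)
qed

text \<open>One half of the identity between the complement of the range of \<open>T - \<mu>\<close>
  and the kernel of the adjoint of \<open>T - \<mu>\<close>.\<close>

lemma orth_ran_minus:
  assumes "self_adjoint T" "y \<in> orth (ran_minus T \<mu>)"
  shows "(y, cnj \<mu> *\<^sub>C y) \<in> T"
proof (rule self_adjoint_memI[OF assms(1)])
  fix x f assume "(x, f) \<in> T"
  then have "cinner y (f - \<mu> *\<^sub>C x) = 0"
    using assms(2) ran_minusI[of x f T \<mu>] by (simp add: in_orth_iff)
  then show "cinner (cnj \<mu> *\<^sub>C y) x = cinner y f"
    by (simp add: cinner_simps)
qed

text \<open>The bound at \<mu> makes the range closed: Cauchy images have Cauchy preimages, and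
  \<open>T\<close> is closed. The bound at \<open>cnj \<mu>\<close> kills the kernel that contains
  the orthogonal complement of the range.\<close>

lemma bounded_below_surj:
  fixes T :: "('a::chilbert \<times> 'a) set"
  assumes T: "lin_rel T" "self_adjoint T"
    and b: "bounded_below_at T \<mu>" and b': "bounded_below_at T (cnj \<mu>)"
  obtains x f where "(x, f) \<in> T" "f - \<mu> *\<^sub>C x = y"
proof -
  obtain c where c: "c > 0" "\<And>x f. (x, f) \<in> T \<Longrightarrow> c * norm x \<le> norm (f - \<mu> *\<^sub>C x)"
    using b by (auto simp: bounded_below_at_def)
  have "closed (ran_minus T \<mu>)"
    unfolding closed_sequential_limits
  proof (intro allI impI)
    fix w z assume *: "(\<forall>n. w n \<in> ran_minus T \<mu>) \<and> w \<longlonglongrightarrow> z"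
    then have "\<forall>n. \<exists>x f. (x, f) \<in> T \<and> w n = f - \<mu> *\<^sub>C x"
      unfolding ran_minus_def by blast
    then obtain x f where xf: "\<And>n. (x n, f n) \<in> T" and w: "\<And>n. w n = f n - \<mu> *\<^sub>C x n"
      by metis
    have diff: "c * norm (x m - x n) \<le> norm (w m - w n)" for m n
    proof -
      have "(f m - f n) - \<mu> *\<^sub>C (x m - x n) = w m - w n"
        by (simp add: w cvec.scale_right_diff_distrib)
      then show ?thesis
        using c(2)[OF lin_rel_diff[OF T(1) xf[of m] xf[of n]]] by simp
    qed
    have "Cauchy x"
      unfolding Cauchy_iff
    proof (intro allI impI)
      fix e :: real assume "e > 0"
      have "Cauchy w"
        using * LIMSEQ_imp_Cauchy by blast
      then obtain N where N: "\<And>m n. m \<ge> N \<Longrightarrow> n \<ge> N \<Longrightarrow> norm (w m - w n) < c * e"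
        using \<open>e > 0\<close> \<open>c > 0\<close> unfolding Cauchy_iff by (meson mult_pos_pos)
      have "norm (x m - x n) < e" if "m \<ge> N" "n \<ge> N" for m n
        using order_le_less_trans[OF diff N[OF that]] \<open>c > 0\<close> by simp
      then show "\<exists>N. \<forall>m\<ge>N. \<forall>n\<ge>N. norm (x m - x n) < e"
        by blast
    qed
    then obtain l where l: "x \<longlonglongrightarrow> l"
      using Cauchy_convergent convergent_def by blast
    have "(\<lambda>n. w n + \<mu> *\<^sub>C x n) \<longlonglongrightarrow> z + \<mu> *\<^sub>C l"
      using * l by (intro tendsto_add tendsto_scaleC) auto
    then have "f \<longlonglongrightarrow> z + \<mu> *\<^sub>C l"
      by (simp add: w)
    then have "(l, z + \<mu> *\<^sub>C l) \<in> T"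
      using self_adjoint_limit[OF T(2) xf l] by blast
    then show "z \<in> ran_minus T \<mu>"
      using ran_minusI[of l "z + \<mu> *\<^sub>C l" T \<mu>] by simp
  qed
  then obtain p where p: "p \<in> ran_minus T \<mu>" "y - p \<in> orth (ran_minus T \<mu>)"
    using orth_projection_exists[OF subspace_ran_minus[OF T(1)]] by metis
  have "(y - p, cnj \<mu> *\<^sub>C (y - p)) \<in> T"
    using orth_ran_minus[OF T(2) p(2)] .
  then have "y - p = 0"
    using b' unfolding bounded_below_at_def by (force simp: mult_le_0_iff)
  then show ?thesis
    using p(1) that by (auto simp: ran_minus_def)
qed

lemma bounded_below_nonreal: "hermitian T \<Longrightarrow> Im \<mu> \<noteq> 0 \<Longrightarrow> bounded_below_at T \<mu>"
  unfolding bounded_below_at_def using hermitian_nonreal_bound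
  by (intro exI[of _ "\<bar>Im \<mu>\<bar>"]) auto

lemma bounded_below_cnj:
  assumes "hermitian T" "bounded_below_at T \<mu>"
  shows "bounded_below_at T (cnj \<mu>)"
proof (cases "Im \<mu> = 0")
  case True
  then have "cnj \<mu> = \<mu>"
    by (simp add: complex_eq_iff)
  then show ?thesis
    using assms by simp
qed (use assms bounded_below_nonreal[of T "cnj \<mu>"] in simp)

lemma resolvent_set_iff_bounded_below:
  fixes T :: "('a::chilbert \<times> 'a) set"
  assumes T: "lin_rel T" "self_adjoint T"
  shows "\<mu> \<in> resolvent_set T \<longleftrightarrow> bounded_below_at T \<mu>"
proof
  have mem: "(y, x) \<in> rinv (lam_minus \<mu> T) \<longleftrightarrow> (x, \<mu> *\<^sub>C x - y) \<in> T" for x y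
  proof
    assume "(y, x) \<in> rinv (lam_minus \<mu> T)"
    then obtain f where "(x, f) \<in> T" "y = \<mu> *\<^sub>C x - f"
      by (auto simp: rinv_def lam_minus_def)
    then show "(x, \<mu> *\<^sub>C x - y) \<in> T"
      by simp
  next
    assume "(x, \<mu> *\<^sub>C x - y) \<in> T"
    then have "(x, \<mu> *\<^sub>C x - (\<mu> *\<^sub>C x - y)) \<in> lam_minus \<mu> T"
      unfolding lam_minus_def by blast
    then show "(y, x) \<in> rinv (lam_minus \<mu> T)"
      by (simp add: rinv_def)
  qed
  {
    assume "\<mu> \<in> resolvent_set T"
    then have "\<exists>C. \<forall>y x. (y, x) \<in> rinv (lam_minus \<mu> T) \<longrightarrow> norm x \<le> C * norm y"
      by (simp add: resolvent_set_def bounded_everywhere_op_def)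
    then obtain C where C: "\<And>y x. (x, \<mu> *\<^sub>C x - y) \<in> T \<Longrightarrow> norm x \<le> C * norm y"
      unfolding mem by blast
    show "bounded_below_at T \<mu>"
      unfolding bounded_below_at_def
    \<comment> \<open>The constant \<open>C\<close> from the definition may be zero or negative,
      hence \<open>\<bar>C\<bar> + 1\<close>.\<close>
    proof (intro exI[of _ "1 / (\<bar>C\<bar> + 1)"] conjI allI impI)
      fix x f assume "(x, f) \<in> T"
      then have "norm x \<le> C * norm (\<mu> *\<^sub>C x - f)"
        using C[of x "\<mu> *\<^sub>C x - f"] by simp
      also have "\<dots> \<le> (\<bar>C\<bar> + 1) * norm (\<mu> *\<^sub>C x - f)"
        by (intro mult_right_mono) auto
      finally show "1 / (\<bar>C\<bar> + 1) * norm x \<le> norm (f - \<mu> *\<^sub>C x)"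
        by (simp add: norm_minus_commute divide_le_eq mult.commute)
    qed simp
  }
  {
    assume b: "bounded_below_at T \<mu>"
    then obtain c where c: "c > 0" "\<And>x f. (x, f) \<in> T \<Longrightarrow> c * norm x \<le> norm (f - \<mu> *\<^sub>C x)"
      by (auto simp: bounded_below_at_def)
    have bd: "norm x \<le> 1 / c * norm y" if "(x, \<mu> *\<^sub>C x - y) \<in> T" for x y
      using c(2)[OF that] \<open>c > 0\<close> by (simp add: field_simps)
    have "lin_rel (rinv (lam_minus \<mu> T))"
      unfolding lin_rel_def mem
    proof (intro conjI allI impI)
      show "(0, \<mu> *\<^sub>C 0 - 0) \<in> T"
        using lin_rel_zero[OF T(1)] by simp
    next
      fix y x z w assume "(x, \<mu> *\<^sub>C x - y) \<in> T \<and> (w, \<mu> *\<^sub>C w - z) \<in> T"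
      then show "(x + w, \<mu> *\<^sub>C (x + w) - (y + z)) \<in> T"
        using lin_rel_add[OF T(1), of x "\<mu> *\<^sub>C x - y" w "\<mu> *\<^sub>C w - z"]
        by (simp add: scaleC_add_right add_diff_add)
    next
      fix k y x assume "(x, \<mu> *\<^sub>C x - y) \<in> T"
      then show "(k *\<^sub>C x, \<mu> *\<^sub>C k *\<^sub>C x - k *\<^sub>C y) \<in> T"
        using lin_rel_scale[OF T(1), of x "\<mu> *\<^sub>C x - y" k]
        by (simp add: cvec.scale_right_diff_distrib mult.commute)
    qed
    moreover have "x = x'" if "(x, \<mu> *\<^sub>C x - y) \<in> T" "(x', \<mu> *\<^sub>C x' - y) \<in> T" for x x' y
      using bd[of "x - x'" 0] lin_rel_diff[OF T(1) that] by (simp add: cvec.scale_right_diff_distrib)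
    moreover have "\<exists>x. (x, \<mu> *\<^sub>C x - y) \<in> T" for y
    proof -
      \<comment> \<open>The target is \<open>- y\<close> because \<open>lam_minus\<close> encodes
        \<mu> minus \<open>T\<close>, with the opposite sign.\<close>
      obtain x f where xf: "(x, f) \<in> T" "f - \<mu> *\<^sub>C x = - y"
        using bounded_below_surj[OF T b bounded_below_cnj[OF self_adjoint_imp_hermitian[OF T(2)] b]] .
      then have "f = \<mu> *\<^sub>C x - y"
        by (simp add: diff_eq_eq)
      then show ?thesis
        using xf(1) by blast
    qed
    ultimately have "bounded_everywhere_op (rinv (lam_minus \<mu> T))"
      unfolding bounded_everywhere_op_def rdom_def mem
      using bd by (intro conjI exI[of _ "1 / c"]) auto
    then show "\<mu> \<in> resolvent_set T"
      by (simp add: resolvent_set_def)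
  }
qed

text \<open>The resolvent at a real point as a function, so that \<open>onorm\<close> applies. It is
  single-valued even if \<open>T\<close> is not: \<open>R\<close> sends \<open>T(0)\<close> to
  0.\<close>

lemma resolvent_map:
  fixes T :: "('a::chilbert \<times> 'a) set" and c :: real
  assumes T: "lin_rel T" "self_adjoint T" and b: "bounded_below_at T (complex_of_real c)"
  obtains R where "bounded_linear R" "\<And>x f. (x, f) \<in> T \<Longrightarrow> R (f - c *\<^sub>R x) = x"
    "\<And>y. (R y, y + c *\<^sub>R R y) \<in> T" "\<And>y z. cinner (R y) z = cinner y (R z)"
proof -
  obtain k where k: "k > 0" "\<And>x f. (x, f) \<in> T \<Longrightarrow> k * norm x \<le> norm (f - c *\<^sub>R x)"
    using b by (auto simp: bounded_below_at_def scaleC_of_real)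
  have "\<exists>x. (x, y + c *\<^sub>R x) \<in> T" for y
  proof -
    obtain x f where "(x, f) \<in> T" "f - complex_of_real c *\<^sub>C x = y"
      using bounded_below_surj[OF T b bounded_below_cnj[OF self_adjoint_imp_hermitian[OF T(2)] b]] .
    then show ?thesis
      by (metis scaleC_of_real diff_add_cancel)
  qed
  then obtain R where R: "\<And>y. (R y, y + c *\<^sub>R R y) \<in> T"
    by metis
  have uniq: "R (f - c *\<^sub>R x) = x" if "(x, f) \<in> T" for x f
  proof -
    let ?y = "f - c *\<^sub>R x"
    have "(?y + c *\<^sub>R R ?y - f) - c *\<^sub>R (R ?y - x) = 0"
      by (simp add: scaleR_diff_right)
    then have "k * norm (R ?y - x) \<le> 0"
      using k(2)[OF lin_rel_diff[OF T(1) R[of ?y] that]] by simp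
    then show ?thesis
      using k(1) by (simp add: mult_le_0_iff)
  qed
  have "bounded_linear R"
  proof (rule bounded_linear_intro)
    fix y z
    have "(y + c *\<^sub>R R y) + (z + c *\<^sub>R R z) - c *\<^sub>R (R y + R z) = y + z"
      by (simp add: scaleR_add_right)
    from uniq[OF lin_rel_add[OF T(1) R[of y] R[of z]], unfolded this] show "R (y + z) = R y + R z" .
  next
    fix r :: real and y
    have "(r *\<^sub>R R y, r *\<^sub>R (y + c *\<^sub>R R y)) \<in> T"
      using lin_rel_scale[OF T(1) R[of y], of "complex_of_real r"] by (simp only: scaleC_of_real)
    moreover have "r *\<^sub>R (y + c *\<^sub>R R y) - c *\<^sub>R (r *\<^sub>R R y) = r *\<^sub>R y"
      by (simp add: scaleR_add_right mult.commute)
    ultimately show "R (r *\<^sub>R y) = r *\<^sub>R R y"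
      using uniq by metis
  next
    fix y
    show "norm (R y) \<le> norm y * (1 / k)"
      using k(2)[OF R[of y]] k(1) by (simp add: field_simps)
  qed
  moreover have "cinner (R y) z = cinner y (R z)" for y z
  proof -
    have "cinner (y + c *\<^sub>R R y) (R z) = cinner (R y) (z + c *\<^sub>R R z)"
      using hermitian_cinner_eq[OF self_adjoint_imp_hermitian[OF T(2)] R[of z] R[of y]] .
    then show ?thesis
      unfolding scaleC_of_real[symmetric] by (simp add: cinner_simps)
  qed
  ultimately show ?thesis
    using that R uniq by blast
qed

text \<open>If the norm \<open>m\<close> of the resolvent at \<open>c\<close> exceeded \<open>1 / r\<close>, then \<open>c + 1 / m\<close> or
  \<open>c - 1 / m\<close> would be a spectral point in the gap, because one of \<open>\<plusminus>m\<close> is in the approximate point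
  spectrum of a bounded symmetric operator of norm \<open>m\<close>.\<close>
lemma spectral_gap_bound:
  fixes T :: "('a::chilbert \<times> 'a) set" and c r :: real
  assumes T: "lin_rel T" "self_adjoint T" and "r > 0"
    and gap: "\<And>s. \<bar>s - c\<bar> < r \<Longrightarrow> bounded_below_at T (complex_of_real s)"
    and xf: "(x, f) \<in> T"
  shows "r * norm x \<le> norm (f - c *\<^sub>R x)"
proof (rule ccontr)
  assume "\<not> ?thesis"
  then have neg: "norm (f - c *\<^sub>R x) < r * norm x"
    by simp
  have "bounded_below_at T (complex_of_real c)"
    using gap[of c] \<open>r > 0\<close> by simp
  then obtain R where R: "bounded_linear R" and Rx: "\<And>x f. (x, f) \<in> T \<Longrightarrow> R (f - c *\<^sub>R x) = x"
    and RT: "\<And>y. (R y, y + c *\<^sub>R R y) \<in> T" and sym: "\<And>y z. cinner (R y) z = cinner y (R z)"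
    using resolvent_map[OF T, of c] by blast
  define m where "m = onorm R"
  have Rle: "norm (R y) \<le> m * norm y" for y
    unfolding m_def by (rule onorm[OF R])
  have "norm x \<le> m * norm (f - c *\<^sub>R x)"
    using Rle[of "f - c *\<^sub>R x"] Rx[OF xf] by simp
  have m0: "0 \<le> m"
    unfolding m_def by (rule onorm_pos_le[OF R])
  have x0: "norm x > 0"
    using neg \<open>r > 0\<close> norm_ge_zero[of "f - c *\<^sub>R x"] by (metis mult_zero_right norm_ge_zero not_less order_le_less)
  have "m > 0"
    using \<open>norm x \<le> m * norm (f - c *\<^sub>R x)\<close> x0 m0 by (cases "m = 0") auto
  have "norm x < m * (r * norm x)"
    using \<open>norm x \<le> m * norm (f - c *\<^sub>R x)\<close> mult_strict_left_mono[OF neg \<open>m > 0\<close>] by simp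
  then have "1 / m < r"
    using x0 \<open>m > 0\<close> by (simp add: field_simps)
  \<comment> \<open>Both candidates \<open>t = m\<close> and \<open>t = - m\<close> are excluded:
    \<open>c + 1 / t\<close> lies in the gap since \<open>1 / m < r\<close>, and the lower bound of
    \<open>T\<close> there carries over to \<open>R - t\<close>.\<close>
  have low: "\<exists>k>0. \<forall>y. k * norm y \<le> norm (R y - t *\<^sub>R y)" if t: "\<bar>t\<bar> = m" for t
  proof -
    have "t \<noteq> 0"
      using t \<open>m > 0\<close> by auto
    have "\<bar>(c + 1 / t) - c\<bar> < r"
      using \<open>1 / m < r\<close> t by (simp add: abs_divide)
    from gap[OF this] obtain d where d: "d > 0"
      "\<And>x f. (x, f) \<in> T \<Longrightarrow> d * norm x \<le> norm (f - (c + 1 / t) *\<^sub>R x)"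
      unfolding bounded_below_at_def scaleC_of_real by blast
    have bd: "m * norm y \<le> (1 + 1 / (m * d)) * norm (R y - t *\<^sub>R y)" for y
    proof -
      \<comment> \<open>The resolvent identity
        \<open>(T - (c + 1/t)) R = - (1/t) (R - t)\<close>.\<close>
      have "(y + c *\<^sub>R R y) - (c + 1 / t) *\<^sub>R R y = - (1 / t) *\<^sub>R (R y - t *\<^sub>R y)"
        using \<open>t \<noteq> 0\<close> by (simp add: scaleR_add_left scaleR_diff_right)
      then have "norm ((y + c *\<^sub>R R y) - (c + 1 / t) *\<^sub>R R y) = 1 / m * norm (R y - t *\<^sub>R y)"
        using t by (simp add: abs_divide)
      then have "d * norm (R y) \<le> 1 / m * norm (R y - t *\<^sub>R y)"
        using d(2)[OF RT[of y]] by simp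
      then have "norm (R y) \<le> 1 / (m * d) * norm (R y - t *\<^sub>R y)"
        using d(1) \<open>m > 0\<close> by (simp add: field_simps)
      moreover have "norm (t *\<^sub>R y) \<le> norm (R y) + norm (R y - t *\<^sub>R y)"
        by (metis norm_triangle_sub norm_minus_commute)
      then have "m * norm y \<le> norm (R y) + norm (R y - t *\<^sub>R y)"
        using t by simp
      ultimately show ?thesis
        by (simp add: distrib_right)
    qed
    have pos: "1 + 1 / (m * d) > 0"
      using d(1) \<open>m > 0\<close> by (simp add: add_pos_pos)
    show ?thesis
    proof (intro exI[of _ "m / (1 + 1 / (m * d))"] conjI allI)
      show "m / (1 + 1 / (m * d)) > 0"
        using pos \<open>m > 0\<close> by simp
      show "m / (1 + 1 / (m * d)) * norm y \<le> norm (R y - t *\<^sub>R y)" for y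
        using bd[of y] pos by (simp add: pos_divide_le_eq mult.commute)
    qed
  qed
  obtain k1 where k1: "k1 > 0" "\<And>y. k1 * norm y \<le> norm (R y - m *\<^sub>R y)"
    using low[of m] \<open>m > 0\<close> by auto
  obtain k2 where k2: "k2 > 0" "\<And>y. k2 * norm y \<le> norm (R y - (- m) *\<^sub>R y)"
    using low[of "- m"] \<open>m > 0\<close> by (metis abs_minus_cancel abs_of_pos)
  \<comment> \<open>\<open>R\<^sup>2 - m\<^sup>2\<close> factors as \<open>(R - m) (R + m)\<close>
    and so is bounded below by \<open>k1 * k2\<close>. Expanding the square of its norm and using
    \<open>norm (R (R y)) \<le> m * norm (R y)\<close> improves the bound of \<open>R\<close> from
    \<open>m\<^sup>2\<close> to \<open>m\<^sup>2 - \<kappa>\<close>, contradicting that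
    \<open>m\<close> is the norm.\<close>
  define \<kappa> where "\<kappa> = (k1 * k2 / m)\<^sup>2"
  have "\<kappa> > 0"
    using k1(1) k2(1) \<open>m > 0\<close> by (simp add: \<kappa>_def)
  have Rsq: "(norm (R y))\<^sup>2 \<le> (m\<^sup>2 - \<kappa>) * (norm y)\<^sup>2" for y
  proof -
    let ?z = "R y - (- m) *\<^sub>R y"
    have "R ?z - m *\<^sub>R ?z = R (R y) - m\<^sup>2 *\<^sub>R y"
      by (simp add: bounded_linear.linear[OF R] linear_add linear_scale scaleR_add_right power2_eq_square)
    moreover have "k1 * (k2 * norm y) \<le> norm (R ?z - m *\<^sub>R ?z)"
      using k1(2)[of ?z] mult_left_mono[OF k2(2)[of y] less_imp_le[OF k1(1)]] by linarith
    ultimately have "k1 * k2 * norm y \<le> norm (R (R y) - m\<^sup>2 *\<^sub>R y)"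
      by (simp add: mult.assoc)
    then have "(k1 * k2 * norm y)\<^sup>2 \<le> (norm (R (R y) - m\<^sup>2 *\<^sub>R y))\<^sup>2"
      using k1(1) k2(1) by (intro power_mono) auto
    also have "\<dots> = (norm (R (R y)))\<^sup>2 - 2 * m\<^sup>2 * (norm (R y))\<^sup>2 + (m\<^sup>2)\<^sup>2 * (norm y)\<^sup>2"
    proof -
      have "cinner (R (R y)) (m\<^sup>2 *\<^sub>R y) = complex_of_real (m\<^sup>2 * (norm (R y))\<^sup>2)"
        unfolding scaleC_of_real[symmetric] cinner_scaleC_right sym[of "R y" y] cinner_self by simp
      then show ?thesis
        by (simp add: norm_diff_square power_mult_distrib)
    qed
    also have "(norm (R (R y)))\<^sup>2 \<le> (m * norm (R y))\<^sup>2"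
      by (intro power_mono Rle) simp
    finally have "(k1 * k2 * norm y)\<^sup>2 \<le> m\<^sup>2 * (m\<^sup>2 * (norm y)\<^sup>2 - (norm (R y))\<^sup>2)"
      by (simp add: algebra_simps power2_eq_square)
    then have "(k1 * k2 * norm y)\<^sup>2 / m\<^sup>2 \<le> m\<^sup>2 * (norm y)\<^sup>2 - (norm (R y))\<^sup>2"
      using \<open>m > 0\<close> by (simp add: pos_divide_le_eq mult.commute)
    moreover have "(k1 * k2 * norm y)\<^sup>2 / m\<^sup>2 = \<kappa> * (norm y)\<^sup>2"
      by (simp add: \<kappa>_def power_mult_distrib power_divide)
    ultimately show ?thesis
      by (simp add: left_diff_distrib)
  qed
  have R_le: "norm (R y) \<le> sqrt (m\<^sup>2 - \<kappa>) * norm y" for y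
    using real_le_rsqrt[OF Rsq[of y]] by (simp add: real_sqrt_mult)
  \<comment> \<open>In HOL \<open>sqrt\<close> of a negative number is negative; the sign of this
    bound is read off from the nonzero vector \<open>x\<close>.\<close>
  then have "0 \<le> sqrt (m\<^sup>2 - \<kappa>) * norm x"
    using norm_ge_zero order_trans by blast
  then have "0 \<le> sqrt (m\<^sup>2 - \<kappa>)"
    using x0 by (simp add: zero_le_mult_iff)
  then have "m \<le> sqrt (m\<^sup>2 - \<kappa>)"
    unfolding m_def using R_le[unfolded m_def] by (rule onorm_bound)
  also have "\<dots> < sqrt (m\<^sup>2)"
    using \<open>\<kappa> > 0\<close> by (intro real_sqrt_less_mono) simp
  finally show False
    using m0 by simp
qed

section \<open>Isolated points of the spectrum\<close>

text \<open>The residual of \<open>x\<close> after projection onto the closed range lies in the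
  kernel, to which \<open>x\<close> is orthogonal; hence it is orthogonal to itself.\<close>

lemma orth_kernel_in_closure_ran:
  fixes T :: "('a::chilbert \<times> 'a) set"
  assumes T: "lin_rel T" "self_adjoint T" and x: "x \<in> orth (eigenspace T (cnj \<mu>))"
  shows "x \<in> closure (ran_minus T \<mu>)"
proof -
  obtain q where q: "q \<in> closure (ran_minus T \<mu>)" "x - q \<in> orth (closure (ran_minus T \<mu>))"
    using orth_projection_exists[OF subspace_closure[OF subspace_ran_minus[OF T(1)]] closed_closure] .
  have "(x - q, cnj \<mu> *\<^sub>C (x - q)) \<in> T"
    using orth_ran_minus[OF T(2)] q(2) by (simp add: orth_closure)
  then have "cinner (x - q) x = 0"
    using x by (auto simp: orth_def eigenspace_def)
  moreover have "cinner (x - q) q = 0"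
    using q by (simp add: in_orth_iff)
  ultimately have "cinner (x - q) (x - q) = 0"
    by (simp add: cinner_diff_right)
  then have "x = q"
    by (simp add: cinner_eq_zero_iff)
  then show ?thesis
    using q by simp
qed

text \<open>The gap inequality makes \<open>\<langle>h, h' - d x'\<rangle>\<close> a positive semidefinite form on the relation, and
  Cauchy-Schwarz for it bounds \<open>L (L - d)\<^sup>-\<^sup>1\<close> from below on the range of \<open>L\<close>.\<close>
lemma bounded_below_orth_kernel_zero:
  fixes L :: "('a::chilbert \<times> 'a) set" and d :: real
  assumes L: "lin_rel L" "self_adjoint L" and "d > 0"
    and gap: "\<And>x h. (x, h) \<in> L \<Longrightarrow> 3 * d * \<bar>Re (cinner h x)\<bar> \<le> (norm h)\<^sup>2"
    and bb: "bounded_below_at L (complex_of_real d)"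
    and xh: "(x, h) \<in> L" "x \<in> orth (eigenspace L 0)"
  shows "d * norm x \<le> 7 / 3 * norm h"
proof -
  have herm: "hermitian L"
    using L self_adjoint_imp_hermitian by blast
  \<comment> \<open>In spectral terms the form \<open>lambda^2 - d * lambda\<close>. The gap makes
    it nonnegative with a margin: \<open>d * Re (cinner h x)\<close> is at most a third of
    \<open>(norm h)\<^sup>2\<close> in modulus, whence the factor 4/3.\<close>
  define q where "q = (\<lambda>x h::'a. (norm h)\<^sup>2 - d * Re (cinner h x))"
  have q_nonneg: "0 \<le> q x h" and q_le: "q x h \<le> 4 / 3 * (norm h)\<^sup>2" if "(x, h) \<in> L" for x h
  proof -
    have "\<bar>d * Re (cinner h x)\<bar> \<le> (norm h)\<^sup>2 / 3"
      using gap[OF that] \<open>d > 0\<close> by (simp add: abs_mult)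
    then have *: "d * Re (cinner h x) \<le> (norm h)\<^sup>2 / 3" "- (d * Re (cinner h x)) \<le> (norm h)\<^sup>2 / 3"
      by (simp_all add: abs_le_iff)
    show "0 \<le> q x h" "q x h \<le> 4 / 3 * (norm h)\<^sup>2"
      unfolding q_def using * zero_le_power2[of "norm h"] by linarith+
  qed
  \<comment> \<open>The form of \<open>(x, h)\<close> against \<open>(x', h')\<close> is
    \<open>cinner h (h' - d x')\<close>, here \<open>(norm h)\<^sup>2\<close>. Cauchy-Schwarz bounds
    its square by \<open>q x h * q x' h'\<close>, and \<open>q x' h'\<close> is the real part of
    \<open>cinner h' h\<close>; cancelling \<open>(norm h) ^ 3\<close> leaves the claim.\<close>
  have ran: "norm h \<le> 4 / 3 * norm h'" if p: "(x, h) \<in> L" and p': "(x', h') \<in> L" "h' - d *\<^sub>R x' = h"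
    for x h x' h'
  proof (cases "h = 0")
    case False
    define c where "c = cinner h h' - complex_of_real d * cinner h x'"
    have "c = cinner h (h' - complex_of_real d *\<^sub>C x')"
      by (simp add: c_def cinner_simps)
    then have c: "c = complex_of_real ((norm h)\<^sup>2)"
      using p'(2) by (simp add: scaleC_of_real cinner_self)
    have "(cmod c)\<^sup>2 \<le> q x h * q x' h'"
    proof (rule semi_inner_cauchy_schwarz)
      fix t
      have s: "cinner h' x = cnj (cinner h x')"
        using hermitian_cinner_eq[OF herm p p'(1)] cinner_commute[of x' h] by simp
      have "0 \<le> q (x - t *\<^sub>C x') (h - t *\<^sub>C h')"
        using lin_rel_diff[OF L(1) p lin_rel_scale[OF L(1) p'(1)]] by (rule q_nonneg)
      also have "q (x - t *\<^sub>C x') (h - t *\<^sub>C h')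
          = q x h - 2 * Re (cnj t * c) + (cmod t)\<^sup>2 * q x' h'"
      proof -
        have 1: "(norm (h - t *\<^sub>C h'))\<^sup>2 = (norm h)\<^sup>2 - 2 * Re (cnj t * cinner h h') + (cmod t)\<^sup>2 * (norm h')\<^sup>2"
          by (simp add: norm_diff_square cinner_scaleC_right norm_scaleC power_mult_distrib)
        have "cinner (h - t *\<^sub>C h') (x - t *\<^sub>C x')
            = cinner h x - cnj t * cinner h x' - t * cnj (cinner h x') + (t * cnj t) * cinner h' x'"
          by (simp add: cinner_simps s algebra_simps)
        also have "t * cnj t = complex_of_real ((cmod t)\<^sup>2)"
          by (rule complex_norm_square[symmetric])
        also have "Re (cinner h x - cnj t * cinner h x' - t * cnj (cinner h x')
              + complex_of_real ((cmod t)\<^sup>2) * cinner h' x')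
            = Re (cinner h x) - 2 * Re (cnj t * cinner h x') + (cmod t)\<^sup>2 * Re (cinner h' x')"
          by simp
        finally have 2: "Re (cinner (h - t *\<^sub>C h') (x - t *\<^sub>C x'))
            = Re (cinner h x) - 2 * Re (cnj t * cinner h x') + (cmod t)\<^sup>2 * Re (cinner h' x')" .
        have 3: "Re (cnj t * c) = Re (cnj t * cinner h h') - d * Re (cnj t * cinner h x')"
          by (simp add: c_def algebra_simps)
        show ?thesis
          unfolding q_def 1 2 3 by (simp add: algebra_simps)
      qed
      finally show "0 \<le> q x h - 2 * Re (cnj t * c) + (cmod t)\<^sup>2 * q x' h'" .
    qed (use q_nonneg p p' in auto)
    also have "\<dots> \<le> (4 / 3 * (norm h)\<^sup>2) * (norm h' * norm h)"
    proof (rule mult_mono)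
      have "q x' h' = Re (cinner h' (h' - complex_of_real d *\<^sub>C x'))"
        by (simp add: q_def cinner_simps cinner_self)
      also have "\<dots> = Re (cinner h' h)"
        using p'(2) by (simp add: scaleC_of_real)
      also have "\<dots> \<le> norm h' * norm h"
        using cinner_cauchy_schwarz[of h' h] complex_Re_le_cmod order_trans by blast
      finally show "q x' h' \<le> norm h' * norm h" .
    qed (use q_nonneg q_le p p' in auto)
    finally have "norm h * (norm h) ^ 3 \<le> (4 / 3 * norm h') * (norm h) ^ 3"
      unfolding c by (simp add: power2_eq_square power3_eq_cube norm_mult mult_ac)
    then show ?thesis
      using False by simp
  qed simp
  \<comment> \<open>Extension to the closure of the range: \<open>h' = z + d R z\<close> depends
    continuously on \<open>z\<close>.\<close>
  have cl: "norm z \<le> 4 / 3 * norm h'"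
    if z: "z \<in> closure (ran_minus L 0)" and p': "(x', h') \<in> L" "h' - d *\<^sub>R x' = z" for z x' h'
  proof -
    obtain R where R: "bounded_linear R" and Rx: "\<And>x f. (x, f) \<in> L \<Longrightarrow> R (f - d *\<^sub>R x) = x"
      and RT: "\<And>y. (R y, y + d *\<^sub>R R y) \<in> L" and "\<And>y z. cinner (R y) z = cinner y (R z)"
      using resolvent_map[OF L bb] by blast
    obtain w where w: "\<And>n. w n \<in> ran_minus L 0" "w \<longlonglongrightarrow> z"
      using z unfolding closure_sequential by blast
    have "norm (w n) \<le> 4 / 3 * norm (w n + d *\<^sub>R R (w n))" for n
    proof -
      obtain x where "(x, w n) \<in> L"
        using w(1)[of n] by (auto simp: ran_minus_def)
      then show ?thesis
        using ran[OF _ RT[of "w n"]] by simp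
    qed
    moreover have "(\<lambda>n. norm (w n)) \<longlonglongrightarrow> norm z"
      using w(2) by (rule tendsto_norm)
    moreover have "(\<lambda>n. 4 / 3 * norm (w n + d *\<^sub>R R (w n))) \<longlonglongrightarrow> 4 / 3 * norm (z + d *\<^sub>R R z)"
      using w(2) bounded_linear.tendsto[OF R w(2)]
      by (intro tendsto_mult tendsto_norm tendsto_add tendsto_scaleR tendsto_const)
    ultimately have "norm z \<le> 4 / 3 * norm (z + d *\<^sub>R R z)"
      by (intro LIMSEQ_le) auto
    moreover have "R z = x'"
      using Rx[OF p'(1)] p'(2) by simp
    ultimately show ?thesis
      using p'(2) by (metis diff_add_cancel)
  qed
  have "x \<in> closure (ran_minus L 0)"
    using orth_kernel_in_closure_ran[OF L, of x 0] xh(2) by simp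
  moreover have "h \<in> closure (ran_minus L 0)"
    using ran_minusI[OF xh(1), of 0] closure_subset by auto
  moreover have sub: "cvec.subspace (closure (ran_minus L 0))"
    using subspace_closure[OF subspace_ran_minus[OF L(1)]] .
  \<comment> \<open>\<open>cl\<close> is applied to \<open>z = h - d x\<close>, whose preimage under
    \<open>L - d\<close> is the pair \<open>(x, h)\<close> itself. The triangle inequality then
    gives \<open>1 + 4/3 = 7/3\<close>.\<close>
  ultimately have "h - d *\<^sub>R x \<in> closure (ran_minus L 0)"
    unfolding scaleC_of_real[symmetric] using cvec.subspace_diff cvec.subspace_scale by blast
  then have "norm (h - d *\<^sub>R x) \<le> 4 / 3 * norm h"
    using cl xh(1) by blast
  moreover have "norm (d *\<^sub>R x) \<le> norm h + norm (h - d *\<^sub>R x)"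
    by (metis norm_triangle_sub norm_minus_commute)
  ultimately show ?thesis
    using \<open>d > 0\<close> by simp
qed

lemma lin_rel_shift:
  assumes "lin_rel T"
  shows "lin_rel {(x, f - \<mu> *\<^sub>C x) | x f. (x, f) \<in> T}" (is "lin_rel ?L")
proof -
  have mem: "(x, h) \<in> ?L \<longleftrightarrow> (x, h + \<mu> *\<^sub>C x) \<in> T" for x h
    by (auto intro!: exI[of _ "h + \<mu> *\<^sub>C x"])
  show ?thesis
    unfolding lin_rel_def mem
  proof (intro conjI allI impI)
    show "(0, 0 + \<mu> *\<^sub>C 0) \<in> T"
      using lin_rel_zero[OF assms] by simp
  next
    fix x f y g assume "(x, f + \<mu> *\<^sub>C x) \<in> T \<and> (y, g + \<mu> *\<^sub>C y) \<in> T"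
    then show "(x + y, f + g + \<mu> *\<^sub>C (x + y)) \<in> T"
      using lin_rel_add[OF assms, of x "f + \<mu> *\<^sub>C x" y "g + \<mu> *\<^sub>C y"]
      by (simp add: scaleC_add_right add_ac)
  next
    fix c x f assume "(x, f + \<mu> *\<^sub>C x) \<in> T"
    then show "(c *\<^sub>C x, c *\<^sub>C f + \<mu> *\<^sub>C c *\<^sub>C x) \<in> T"
      using lin_rel_scale[OF assms, of x "f + \<mu> *\<^sub>C x" c]
      by (simp add: scaleC_add_right mult.commute)
  qed
qed

lemma self_adjoint_shift:
  assumes "self_adjoint T" "cnj \<mu> = \<mu>"
  shows "self_adjoint {(x, f - \<mu> *\<^sub>C x) | x f. (x, f) \<in> T}" (is "self_adjoint ?L")
proof -
  have mem: "(x, h) \<in> ?L \<longleftrightarrow> (x, h + \<mu> *\<^sub>C x) \<in> T" for x h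
    by (auto intro!: exI[of _ "h + \<mu> *\<^sub>C x"])
  have "(y, g) \<in> ?L \<longleftrightarrow> (y, g) \<in> radj ?L" for y g
  proof
    assume yg: "(y, g) \<in> ?L"
    show "(y, g) \<in> radj ?L"
      unfolding radj_def
    proof (clarsimp)
      fix x f assume "(x, f) \<in> T"
      then have "cinner (g + \<mu> *\<^sub>C y) x = cinner y f"
        using yg hermitian_cinner_eq[OF self_adjoint_imp_hermitian[OF assms(1)]] unfolding mem by blast
      then show "cinner g x = cinner y (f - \<mu> *\<^sub>C x)"
        using assms(2) by (simp add: cinner_simps eq_diff_eq)
    qed
  next
    assume yg: "(y, g) \<in> radj ?L"
    show "(y, g) \<in> ?L"
      unfolding mem
    proof (rule self_adjoint_memI[OF assms(1)])
      fix x f assume "(x, f) \<in> T"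
      then have "(x, f - \<mu> *\<^sub>C x) \<in> ?L"
        by blast
      then have "cinner g x = cinner y (f - \<mu> *\<^sub>C x)"
        using yg unfolding radj_def by blast
      then show "cinner (g + \<mu> *\<^sub>C y) x = cinner y f"
        using assms(2) by (simp add: cinner_simps)
    qed
  qed
  then show ?thesis
    unfolding self_adjoint_def by (simp add: set_eq_iff split_paired_all)
qed

text \<open>Isolation of \<open>s\<close> gives two spectral gaps of length \<open>e\<close>;
  \<open>spectral_gap_bound\<close> at their midpoints supplies the quadratic gap inequality for the
  shifted relation \<open>L\<close>.\<close>

lemma isolated_bounded_below_orth_eigenspace:
  fixes T :: "('a::chilbert \<times> 'a) set" and s :: real
  assumes T: "lin_rel T" "self_adjoint T"
    and isol: "\<not> complex_of_real s islimpt rspectrum T"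
  obtains c where "c > 0"
    "\<And>x f. (x, f) \<in> T \<Longrightarrow> x \<in> orth (eigenspace T (complex_of_real s)) \<Longrightarrow> c * norm x \<le> norm (f - s *\<^sub>R x)"
proof -
  obtain e where e: "e > 0" "\<And>z. z \<in> rspectrum T \<Longrightarrow> z \<noteq> complex_of_real s \<Longrightarrow> e \<le> dist z (complex_of_real s)"
    using isol unfolding islimpt_approachable by (meson not_le)
  have bb: "bounded_below_at T (complex_of_real t)" if "t \<noteq> s" "\<bar>t - s\<bar> < e" for t
  proof -
    have "dist (complex_of_real t) (complex_of_real s) = \<bar>t - s\<bar>"
      by (simp add: dist_norm flip: of_real_diff)
    then have "complex_of_real t \<notin> rspectrum T"
      using e(2)[of "complex_of_real t"] that by auto
    then show ?thesis
      using resolvent_set_iff_bounded_below[OF T] by (simp add: rspectrum_def)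
  qed
  define L where "L = {(x, f - complex_of_real s *\<^sub>C x) | x f. (x, f) \<in> T}"
  have L: "lin_rel L" "self_adjoint L"
    unfolding L_def by (rule lin_rel_shift[OF T(1)], rule self_adjoint_shift[OF T(2)]) simp
  have mem: "(x, h) \<in> L \<longleftrightarrow> (x, h + s *\<^sub>R x) \<in> T" for x h
    unfolding L_def scaleC_of_real by (auto intro!: exI[of _ "h + s *\<^sub>R x"])
  \<comment> \<open>A third of the gap: \<open>3 * d = e\<close> is the constant of the quadratic
    inequality, and \<open>s + d\<close> is still inside the gap.\<close>
  define d where "d = e / 3"
  have "d > 0"
    using e(1) by (simp add: d_def)
  have gap: "3 * d * \<bar>Re (cinner h x)\<bar> \<le> (norm h)\<^sup>2" if "(x, h) \<in> L" for x h
  proof -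
    \<comment> \<open>\<open>s + r\<close> is the midpoint of the gap on either side. Since
      \<open>r\<^sup>2 = (e / 2)\<^sup>2\<close>, the terms in \<open>(norm x)\<^sup>2\<close>
      cancel after squaring.\<close>
    have "2 * r * Re (cinner h x) \<le> (norm h)\<^sup>2" if r: "\<bar>r\<bar> = e / 2" for r :: real
    proof -
      have "e / 2 * norm x \<le> norm (h + s *\<^sub>R x - (s + r) *\<^sub>R x)"
      proof (rule spectral_gap_bound[OF T])
        show "(x, h + s *\<^sub>R x) \<in> T"
          using \<open>(x, h) \<in> L\<close> mem by simp
        show "bounded_below_at T (complex_of_real t)" if "\<bar>t - (s + r)\<bar> < e / 2" for t
          using that r by (intro bb) auto
      qed (use e(1) in simp)
      then have "(e / 2 * norm x)\<^sup>2 \<le> (norm (h - r *\<^sub>R x))\<^sup>2"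
        using e(1) by (intro power_mono) (auto simp: scaleR_add_left)
      also have "\<dots> = (norm h)\<^sup>2 - 2 * r * Re (cinner h x) + (e / 2 * norm x)\<^sup>2"
        unfolding scaleC_of_real[symmetric] norm_diff_square cinner_scaleC_right norm_scaleC
        using r by simp
      finally show ?thesis
        by simp
    qed
    from this[of "e / 2"] this[of "- e / 2"] show ?thesis
      using e(1) by (simp add: d_def abs_if)
  qed
  have "bounded_below_at T (complex_of_real (s + d))"
    using e(1) by (intro bb) (auto simp: d_def)
  then obtain k where k: "k > 0" "\<And>x f. (x, f) \<in> T \<Longrightarrow> k * norm x \<le> norm (f - (s + d) *\<^sub>R x)"
    unfolding bounded_below_at_def scaleC_of_real by blast
  have "bounded_below_at L (complex_of_real d)"
    unfolding bounded_below_at_def scaleC_of_real mem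
  proof (intro exI[of _ k] conjI allI impI)
    fix x h assume "(x, h + s *\<^sub>R x) \<in> T"
    then show "k * norm x \<le> norm (h - d *\<^sub>R x)"
      using k(2)[of x "h + s *\<^sub>R x"] by (simp add: scaleR_add_left)
  qed (rule k(1))
  note main = bounded_below_orth_kernel_zero[OF L \<open>d > 0\<close> gap this]
  show ?thesis
  proof (rule that[of "3 / 7 * d"])
    fix x f assume xf: "(x, f) \<in> T" and x: "x \<in> orth (eigenspace T (complex_of_real s))"
    have "eigenspace L 0 = eigenspace T (complex_of_real s)"
      by (simp add: eigenspace_def mem scaleC_of_real)
    then have "d * norm x \<le> 7 / 3 * norm (f - s *\<^sub>R x)"
      using main[of x "f - s *\<^sub>R x"] xf x by (simp add: mem)
    then show "3 / 7 * d * norm x \<le> norm (f - s *\<^sub>R x)"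
      by simp
  qed (use \<open>d > 0\<close> in simp)
qed

section \<open>Weakly null and singular sequences\<close>

definition weakly_null :: "(nat \<Rightarrow> 'a::complex_inner) \<Rightarrow> bool" where
  "weakly_null x \<longleftrightarrow> (\<forall>w. (\<lambda>n. cinner (x n) w) \<longlonglongrightarrow> 0)"

text \<open>The uniform norm bound lets convergence be tested on a dense subset.\<close>

lemma weakly_null_on_closure:
  fixes x :: "nat \<Rightarrow> 'a::complex_inner"
  assumes x: "\<And>n. norm (x n) \<le> 1" and lim: "\<And>w. w \<in> M \<Longrightarrow> (\<lambda>n. cinner (x n) w) \<longlonglongrightarrow> 0"
    and w: "w \<in> closure M"
  shows "(\<lambda>n. cinner (x n) w) \<longlonglongrightarrow> 0"
proof (rule LIMSEQ_I)
  fix e :: real assume "e > 0"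
  then obtain v where v: "v \<in> M" "dist v w < e / 2"
    using w unfolding closure_approachable by (meson half_gt_zero)
  obtain N where N: "\<And>n. n \<ge> N \<Longrightarrow> norm (cinner (x n) v - 0) < e / 2"
    using LIMSEQ_D[OF lim[OF v(1)], of "e / 2"] \<open>e > 0\<close> by auto
  have "norm (cinner (x n) w - 0) < e" if "n \<ge> N" for n
  proof -
    have "cmod (cinner (x n) (w - v)) \<le> norm (x n) * norm (w - v)"
      by (rule cinner_cauchy_schwarz)
    also have "\<dots> \<le> 1 * norm (w - v)"
      using x by (intro mult_right_mono) auto
    also have "\<dots> < e / 2"
      using v(2) by (simp add: dist_norm norm_minus_commute)
    finally have "cmod (cinner (x n) (w - v)) < e / 2" .
    moreover have "cinner (x n) w = cinner (x n) (w - v) + cinner (x n) v"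
      by (simp add: cinner_diff_right)
    ultimately show ?thesis
      using N[OF that] norm_triangle_ineq[of "cinner (x n) (w - v)" "cinner (x n) v"] by simp
  qed
  then show "\<exists>N. \<forall>n\<ge>N. norm (cinner (x n) w - 0) < e"
    by blast
qed

section \<open>Orthonormal sets, finite-dimensional spaces and Bessel's inequality\<close>

definition orthonormal :: "'a::complex_inner set \<Rightarrow> bool" where
  "orthonormal G \<longleftrightarrow> (\<forall>g\<in>G. norm g = 1) \<and> (\<forall>g\<in>G. \<forall>h\<in>G. g \<noteq> h \<longrightarrow> cinner g h = 0)"

lemma orthonormal_residual:
  assumes "finite G" "orthonormal G" "g \<in> G"
  shows "cinner (x - (\<Sum>h\<in>G. cinner x h *\<^sub>C h)) g = 0"
proof -
  have "cinner (\<Sum>h\<in>G. cinner x h *\<^sub>C h) g = (\<Sum>h\<in>G. if h = g then cinner x g else 0)"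
    unfolding cinner_sum_left
    using assms by (intro sum.cong) (auto simp: cinner_scaleC_left orthonormal_def cinner_self)
  also have "\<dots> = cinner x g"
    using assms by simp
  finally show ?thesis
    by (simp add: cinner_diff_left)
qed

lemma orthonormal_insert_normalised:
  assumes "orthonormal G" "r \<noteq> 0" "\<And>g. g \<in> G \<Longrightarrow> cinner r g = 0"
  shows "orthonormal (insert (complex_of_real (1 / norm r) *\<^sub>C r) G)"
proof -
  have "norm (complex_of_real (1 / norm r) *\<^sub>C r) = 1"
    using assms(2) by (simp add: norm_scaleC norm_divide)
  moreover have "cinner (complex_of_real (1 / norm r) *\<^sub>C r) g = 0"
    "cinner g (complex_of_real (1 / norm r) *\<^sub>C r) = 0" if "g \<in> G" for g
    using assms(3)[OF that] cinner_eq_zero_commute[of g r]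
    by (simp_all add: cinner_scaleC_left cinner_scaleC_right)
  ultimately show ?thesis
    using assms(1) unfolding orthonormal_def by auto
qed

lemma orthonormal_spanning:
  assumes "finite (F :: 'a::complex_inner set)"
  shows "\<exists>G. finite G \<and> orthonormal G \<and> F \<subseteq> cvec.span G"
  using assms
proof (induction F rule: finite_induct)
  case empty
  then show ?case
    by (intro exI[of _ "{}"]) (simp add: orthonormal_def)
next
  case (insert a F)
  then obtain G where G: "finite G" "orthonormal G" "F \<subseteq> cvec.span G"
    by blast
  define p where "p = (\<Sum>h\<in>G. cinner a h *\<^sub>C h)"
  have p: "p \<in> cvec.span G"
    unfolding p_def by (intro cvec.span_sum cvec.span_scale cvec.span_base)
  show ?case
  proof (cases "a = p")
    case True
    then show ?thesis
      using G p by blast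
  next
    case False
    define v where "v = complex_of_real (1 / norm (a - p)) *\<^sub>C (a - p)"
    have "cinner (a - p) g = 0" if "g \<in> G" for g
      unfolding p_def using orthonormal_residual[OF G(1,2) that] .
    then have "orthonormal (insert v G)"
      unfolding v_def using False by (intro orthonormal_insert_normalised[OF G(2)]) auto
    moreover have "complex_of_real (norm (a - p)) *\<^sub>C v \<in> cvec.span (insert v G)"
      by (intro cvec.span_scale cvec.span_base) simp
    then have "a - p \<in> cvec.span (insert v G)"
      using False by (simp add: v_def flip: of_real_mult)
    then have "a - p + p \<in> cvec.span (insert v G)"
      using p cvec.span_mono[of G "insert v G"] by (intro cvec.span_add) auto
    moreover have "F \<subseteq> cvec.span (insert v G)"
      using G(3) cvec.span_mono[of G "insert v G"] by blast
    ultimately show ?thesis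
      using G(1) by (intro exI[of _ "insert v G"]) auto
  qed
qed

lemma orthonormal_expansion:
  assumes "finite G" "orthonormal G" "y \<in> cvec.span G"
  shows "y = (\<Sum>g\<in>G. cinner y g *\<^sub>C g)"
proof -
  define r where "r = y - (\<Sum>g\<in>G. cinner y g *\<^sub>C g)"
  have "r \<in> cvec.span G"
    unfolding r_def using assms(3)
    by (intro cvec.span_diff cvec.span_sum cvec.span_scale) (auto intro: cvec.span_base)
  moreover have "G \<subseteq> orth {r}"
    using orthonormal_residual[OF assms(1,2), of _ y] by (auto simp: orth_def r_def)
  then have "cvec.span G \<subseteq> orth {r}"
    using subspace_orth by (rule cvec.span_minimal)
  ultimately have "r = 0"
    by (auto simp: orth_def cinner_eq_zero_iff)
  then show ?thesis
    by (simp add: r_def)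
qed

text \<open>Expansion in a finite orthonormal set whose span contains \<open>E\<close> reduces norm
  convergence to that of finitely many coefficients.\<close>

lemma weakly_null_finite_dim_tendsto:
  fixes y :: "nat \<Rightarrow> 'a::complex_inner"
  assumes "weakly_null y" "\<And>n. y n \<in> E" "cfin_dim E"
  shows "y \<longlonglongrightarrow> 0"
proof -
  obtain F where F: "finite F" "E \<subseteq> cvec.span F"
    using assms(3) by (auto simp: cfin_dim_def)
  obtain G where G: "finite G" "orthonormal G" "F \<subseteq> cvec.span G"
    using orthonormal_spanning[OF F(1)] by blast
  have "cvec.span F \<subseteq> cvec.span G"
    using G(3) by (intro cvec.span_minimal cvec.subspace_span)
  then have "y n \<in> cvec.span G" for n
    using assms(2) F(2) by blast
  then have "y n = (\<Sum>g\<in>G. cinner (y n) g *\<^sub>C g)" for n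
    by (rule orthonormal_expansion[OF G(1,2)])
  then have eq: "(\<lambda>n. \<Sum>g\<in>G. cinner (y n) g *\<^sub>C g) = y"
    by (intro ext) (rule sym)
  have "(\<lambda>n. \<Sum>g\<in>G. cinner (y n) g *\<^sub>C g) \<longlonglongrightarrow> (\<Sum>g\<in>G. 0)"
  proof (rule tendsto_sum)
    fix g
    have "(\<lambda>n. cmod (cinner (y n) g)) \<longlonglongrightarrow> 0"
      using assms(1) by (intro tendsto_norm_zero) (simp add: weakly_null_def)
    then show "(\<lambda>n. cinner (y n) g *\<^sub>C g) \<longlonglongrightarrow> 0"
      by (rule tendsto_of_bounded_by[where C = "norm g", rotated]) (simp add: norm_scaleC)
  qed
  then show ?thesis
    unfolding eq by simp
qed

lemma bessel_inequality:
  assumes "finite G" "orthonormal G"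
  shows "(\<Sum>g\<in>G. (cmod (cinner w g))\<^sup>2) \<le> (norm w)\<^sup>2"
proof -
  define p where "p = (\<Sum>g\<in>G. cinner w g *\<^sub>C g)"
  have res: "cinner g (w - p) = 0" if "g \<in> G" for g
    unfolding p_def using orthonormal_residual[OF assms that] cinner_eq_zero_commute by blast
  have "cinner p (w - p) = 0"
    by (subst p_def) (simp add: cinner_sum_left cinner_scaleC_left res)
  then have pw: "cinner p w = cinner p p"
    by (simp add: cinner_diff_right)
  then have "cinner w p = cinner p w"
    using cinner_commute[of w p] by (simp add: cinner_self)
  then have "cinner (w - p) (w - p) = cinner w w - cinner p w"
    using pw by (simp add: cinner_diff_left cinner_diff_right)
  moreover have "cinner p w = complex_of_real (\<Sum>g\<in>G. (cmod (cinner w g))\<^sup>2)"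
    unfolding p_def cinner_sum_left of_real_sum cinner_scaleC_left complex_norm_square
    by (simp only: cinner_commute[of w, symmetric] cinner_commute[of _ w])
  ultimately have "complex_of_real ((norm (w - p))\<^sup>2)
      = complex_of_real ((norm w)\<^sup>2 - (\<Sum>g\<in>G. (cmod (cinner w g))\<^sup>2))"
    by (simp only: cinner_self of_real_diff)
  then have "(norm (w - p))\<^sup>2 = (norm w)\<^sup>2 - (\<Sum>g\<in>G. (cmod (cinner w g))\<^sup>2)"
    by (simp only: of_real_eq_iff)
  then show ?thesis
    using zero_le_power2[of "norm (w - p)"] by linarith
qed

text \<open>Gram-Schmidt never stops in a space that no finite set spans; Bessel makes the
  coefficients of a fixed vector square summable, so they tend to 0.\<close>

lemma infinite_dim_weakly_null:
  fixes E :: "'a::complex_inner set"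
  assumes E: "cvec.subspace E" and inf: "\<not> cfin_dim E"
  obtains e where "\<And>n. e n \<in> E" "\<And>n. norm (e n) = 1" "weakly_null e"
proof -
  have ex: "\<exists>v. v \<in> E \<and> v \<notin> G \<and> orthonormal (insert v G)" if G: "finite G" "orthonormal G" "G \<subseteq> E" for G
  proof -
    obtain a where a: "a \<in> E" "a \<notin> cvec.span G"
      using inf G(1) by (auto simp: cfin_dim_def)
    define p where "p = (\<Sum>h\<in>G. cinner a h *\<^sub>C h)"
    have p: "p \<in> cvec.span G"
      unfolding p_def by (intro cvec.span_sum cvec.span_scale cvec.span_base)
    have "cvec.span G \<subseteq> E"
      using G(3) E by (rule cvec.span_minimal)
    then have "a - p \<in> E"
      using p a(1) E cvec.subspace_diff by blast
    have "a \<noteq> p"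
      using a p by auto
    define v where "v = complex_of_real (1 / norm (a - p)) *\<^sub>C (a - p)"
    have res: "cinner (a - p) g = 0" if "g \<in> G" for g
      unfolding p_def using orthonormal_residual[OF G(1,2) that] .
    have "v \<notin> G"
    proof
      assume "v \<in> G"
      then have "cinner (a - p) v = 0"
        by (rule res)
      then show False
        using \<open>a \<noteq> p\<close> by (simp add: v_def cinner_scaleC_right cinner_eq_zero_iff)
    qed
    moreover have "orthonormal (insert v G)"
      unfolding v_def using \<open>a \<noteq> p\<close> res by (intro orthonormal_insert_normalised[OF G(2)]) auto
    moreover have "v \<in> E"
      unfolding v_def using \<open>a - p \<in> E\<close> E cvec.subspace_scale by blast
    ultimately show ?thesis
      by blast
  qed
  define pick where "pick G = (SOME v. v \<in> E \<and> v \<notin> G \<and> orthonormal (insert v G))" for G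
  have pick: "pick G \<in> E" "pick G \<notin> G" "orthonormal (insert (pick G) G)"
    if "finite G" "orthonormal G" "G \<subseteq> E" for G
    using someI_ex[OF ex[OF that]] by (simp_all add: pick_def)
  define Gs where "Gs = rec_nat {} (\<lambda>_ G. insert (pick G) G)"
  have Gs: "Gs 0 = {}" "\<And>n. Gs (Suc n) = insert (pick (Gs n)) (Gs n)"
    by (simp_all add: Gs_def)
  have inv: "finite (Gs n) \<and> orthonormal (Gs n) \<and> Gs n \<subseteq> E" for n
  proof (induction n)
    case 0
    show ?case
      by (simp add: Gs orthonormal_def)
  next
    case (Suc n)
    then show ?case
      using pick[of "Gs n"] by (simp add: Gs)
  qed
  define e where "e = (\<lambda>n. pick (Gs n))"
  have e: "e n \<in> E" "e n \<notin> Gs n" "norm (e n) = 1" for n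
    using pick[of "Gs n"] inv[of n] by (auto simp: e_def orthonormal_def)
  \<comment> \<open>\<open>e n\<close> is not in \<open>Gs n\<close>, so no vector repeats and the
    partial sum is a sum over a finite set, as in Bessel's inequality.\<close>
  have sums: "(\<Sum>i<n. (cmod (cinner w (e i)))\<^sup>2) = (\<Sum>g\<in>Gs n. (cmod (cinner w g))\<^sup>2)" for n w
  proof (induction n)
    case 0
    show ?case
      by (simp add: Gs)
  next
    case (Suc n)
    then show ?case
      using e(2)[of n] inv[of n] by (simp add: Gs e_def)
  qed
  have "weakly_null e"
    unfolding weakly_null_def
  proof
    fix w
    have "summable (\<lambda>i. (cmod (cinner w (e i)))\<^sup>2)"
    proof (rule summableI_nonneg_bounded)
      show "(\<Sum>i<n. (cmod (cinner w (e i)))\<^sup>2) \<le> (norm w)\<^sup>2" for n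
        unfolding sums using bessel_inequality inv[of n] by blast
    qed simp
    then have "(\<lambda>i. (cmod (cinner w (e i)))\<^sup>2) \<longlonglongrightarrow> 0"
      by (rule summable_LIMSEQ_zero)
    then have "(\<lambda>i. sqrt ((cmod (cinner w (e i)))\<^sup>2)) \<longlonglongrightarrow> sqrt 0"
      by (rule tendsto_real_sqrt)
    then have "(\<lambda>i. cmod (cinner w (e i))) \<longlonglongrightarrow> 0"
      by simp
    moreover have "cmod (cinner w (e i)) = cmod (cinner (e i) w)" for i
      using cinner_commute[of w "e i"] by simp
    ultimately have "(\<lambda>i. cmod (cinner (e i) w)) \<longlonglongrightarrow> 0"
      by simp
    then show "(\<lambda>n. cinner (e n) w) \<longlonglongrightarrow> 0"
      by (rule tendsto_norm_zero_cancel)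
  qed
  with e show ?thesis
    using that by blast
qed

text \<open>Weyl sequences. As \<open>T(x n)\<close> may have many elements, the representatives
  \<open>f n\<close> are part of the data.\<close>

definition has_singular_sequence :: "('a::complex_inner \<times> 'a) set \<Rightarrow> complex \<Rightarrow> bool" where
  "has_singular_sequence T \<mu> \<longleftrightarrow> (\<exists>x f. (\<forall>n. (x n, f n) \<in> T) \<and> (\<forall>n. norm (x n) = 1)
     \<and> (\<lambda>n. f n - \<mu> *\<^sub>C x n) \<longlonglongrightarrow> 0 \<and> weakly_null x)"

lemma subspace_eigenspace:
  assumes "lin_rel T"
  shows "cvec.subspace (eigenspace T \<mu>)"
  unfolding cvec.subspace_def eigenspace_def mem_Collect_eq
proof (intro conjI ballI allI)
  show "(0, \<mu> *\<^sub>C 0) \<in> T"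
    using lin_rel_zero[OF assms] by simp
next
  fix x y assume "x \<in> {x. (x, \<mu> *\<^sub>C x) \<in> T}" "y \<in> {x. (x, \<mu> *\<^sub>C x) \<in> T}"
  then show "(x + y, \<mu> *\<^sub>C (x + y)) \<in> T"
    using lin_rel_add[OF assms, of x _ y] by (simp add: scaleC_add_right)
next
  fix c x assume "x \<in> {x. (x, \<mu> *\<^sub>C x) \<in> T}"
  then have "(c *\<^sub>C x, c *\<^sub>C \<mu> *\<^sub>C x) \<in> T"
    using lin_rel_scale[OF assms, of x "\<mu> *\<^sub>C x" c] by simp
  then show "(c *\<^sub>C x, \<mu> *\<^sub>C c *\<^sub>C x) \<in> T"
    by (simp add: mult.commute)
qed

lemma closed_eigenspace:
  assumes "self_adjoint T"
  shows "closed (eigenspace T \<mu>)"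
  unfolding closed_sequential_limits eigenspace_def mem_Collect_eq
  using self_adjoint_limit[OF assms _ _ tendsto_scaleC] by blast

lemma not_bounded_below_approx:
  assumes T: "lin_rel T" "\<not> bounded_below_at T \<mu>" and "e > 0"
  obtains x f where "(x, f) \<in> T" "norm x = 1" "norm (f - \<mu> *\<^sub>C x) < e"
proof -
  obtain x f where xf: "(x, f) \<in> T" "norm (f - \<mu> *\<^sub>C x) < e * norm x"
    using assms unfolding bounded_below_at_def by (meson not_le)
  then have "norm x > 0"
    using \<open>e > 0\<close> by (metis mult_zero_right norm_ge_zero not_less order_le_less)
  define c where "c = complex_of_real (1 / norm x)"
  have nc: "cmod c = 1 / norm x"
    by (simp add: c_def norm_divide)
  have eq: "c *\<^sub>C f - \<mu> *\<^sub>C c *\<^sub>C x = c *\<^sub>C (f - \<mu> *\<^sub>C x)"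
    by (simp add: cvec.scale_right_diff_distrib mult.commute)
  have "norm (c *\<^sub>C f - \<mu> *\<^sub>C c *\<^sub>C x) < e"
    unfolding eq norm_scaleC nc using xf(2) \<open>norm x > 0\<close> by (simp add: field_simps)
  moreover have "norm (c *\<^sub>C x) = 1"
    using \<open>norm x > 0\<close> by (simp add: norm_scaleC nc)
  ultimately show ?thesis
    using that lin_rel_scale[OF T(1) xf(1)] by blast
qed

lemma rspectrum_real:
  fixes T :: "('a::chilbert \<times> 'a) set"
  assumes "lin_rel T" "self_adjoint T" "\<mu> \<in> rspectrum T"
  shows "cnj \<mu> = \<mu>"
proof -
  have "\<not> bounded_below_at T \<mu>"
    using assms by (simp add: rspectrum_def resolvent_set_iff_bounded_below)
  then have "Im \<mu> = 0"
    using bounded_below_nonreal self_adjoint_imp_hermitian assms(2) by blast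
  then show ?thesis
    by (simp add: complex_eq_iff)
qed

text \<open>The approximation error is chosen small compared with \<open>\<bar>\<mu> - z n\<bar>\<close>, so that the approximate
  eigenvectors become orthogonal to the kernel of \<open>T - \<mu>\<close>; on the closure of the range of \<open>T - \<mu>\<close>
  weak convergence is automatic.\<close>
lemma limit_point_singular_sequence:
  fixes T :: "('a::chilbert \<times> 'a) set"
  assumes T: "lin_rel T" "self_adjoint T" and \<mu>: "cnj \<mu> = \<mu>" and lim: "\<mu> islimpt rspectrum T"
  shows "has_singular_sequence T \<mu>"
proof -
  have herm: "hermitian T"
    using T self_adjoint_imp_hermitian by blast
  obtain z where z: "\<And>n. z n \<in> rspectrum T - {\<mu>}" and z_lim: "z \<longlonglongrightarrow> \<mu>"
    using lim unfolding islimpt_sequential by blast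
  \<comment> \<open>After division by \<open>cmod (\<mu> - z n)\<close> an error of
    \<open>1 / (n + 1)\<close> remains, which forces the components along the kernel to 0.\<close>
  define e where "e = (\<lambda>n. cmod (\<mu> - z n) / (real n + 1))"
  have e0: "e n > 0" for n
    using z[of n] by (auto simp: e_def)
  have "\<exists>x f. (x, f) \<in> T \<and> norm x = 1 \<and> norm (f - z n *\<^sub>C x) < e n" for n
  proof -
    have "\<not> bounded_below_at T (z n)"
      using z[of n] resolvent_set_iff_bounded_below[OF T] by (simp add: rspectrum_def)
    then show ?thesis
      using not_bounded_below_approx[OF T(1) _ e0[of n]] by metis
  qed
  then obtain x f where xf: "\<And>n. (x n, f n) \<in> T" and x1: "\<And>n. norm (x n) = 1"
    and f: "\<And>n. norm (f n - z n *\<^sub>C x n) < e n"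
    by metis
  have z0: "(\<lambda>n. cmod (\<mu> - z n)) \<longlonglongrightarrow> 0"
    using tendsto_norm[OF tendsto_diff[OF tendsto_const[of \<mu>] z_lim]] by simp
  have lim0: "(\<lambda>n. f n - \<mu> *\<^sub>C x n) \<longlonglongrightarrow> 0"
  proof (rule tendsto_of_bounded_by[OF _ z0])
    fix n
    have "f n - \<mu> *\<^sub>C x n = (f n - z n *\<^sub>C x n) - (\<mu> - z n) *\<^sub>C x n"
      by (simp add: cvec.scale_left_diff_distrib)
    then have "norm (f n - \<mu> *\<^sub>C x n) \<le> norm (f n - z n *\<^sub>C x n) + norm ((\<mu> - z n) *\<^sub>C x n)"
      using norm_triangle_ineq4 by metis
    also have "\<dots> \<le> e n + cmod (\<mu> - z n)"
      using f[of n] by (simp add: norm_scaleC x1)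
    also have "e n \<le> cmod (\<mu> - z n)"
      by (simp add: e_def divide_le_eq mult_le_cancel_left1)
    finally show "norm (f n - \<mu> *\<^sub>C x n) \<le> 2 * cmod (\<mu> - z n)"
      by simp
  qed
  \<comment> \<open>On the range, \<open>T - \<mu>\<close> is moved to the other side of the inner
    product, where it tends to 0.\<close>
  have on_ran: "(\<lambda>n. cinner (x n) w) \<longlonglongrightarrow> 0" if w: "w \<in> ran_minus T \<mu>" for w
  proof -
    obtain y g where yg: "(y, g) \<in> T" "w = g - \<mu> *\<^sub>C y"
      using w unfolding ran_minus_def by blast
    have "cinner (x n) w = cinner (f n - \<mu> *\<^sub>C x n) y" for n
      using hermitian_cinner_eq[OF herm yg(1) xf[of n]] \<mu> by (simp add: yg(2) cinner_simps)
    then show ?thesis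
      using tendsto_cinner_left[OF lim0, of y] by simp
  qed
  \<comment> \<open>For \<open>p\<close> in the kernel, pairing \<open>f n - z n x n\<close> with
    \<open>p\<close> gives \<open>(\<mu> - z n)\<close> times the coefficient; the small error
    \<open>e n\<close> pays for the division.\<close>
  have on_ker: "(\<lambda>n. cinner (x n) p) \<longlonglongrightarrow> 0" if "(p, \<mu> *\<^sub>C p) \<in> T" for p
  proof (rule tendsto_of_bounded_by[where C = "norm p"])
    show "(\<lambda>n. 1 / (real n + 1)) \<longlonglongrightarrow> 0"
      using LIMSEQ_Suc[OF lim_inverse_n'] by (simp add: add.commute)
    fix n
    have "cinner (f n) p = \<mu> * cinner (x n) p"
      using hermitian_cinner_eq[OF herm that xf[of n]] \<mu> by (simp add: cinner_scaleC_right)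
    then have "cinner (f n - z n *\<^sub>C x n) p = (\<mu> - z n) * cinner (x n) p"
      by (simp add: cinner_simps left_diff_distrib)
    then have "cmod (\<mu> - z n) * cmod (cinner (x n) p) = cmod (cinner (f n - z n *\<^sub>C x n) p)"
      by (simp add: norm_mult)
    also have "\<dots> \<le> norm (f n - z n *\<^sub>C x n) * norm p"
      by (rule cinner_cauchy_schwarz)
    also have "\<dots> \<le> e n * norm p"
      using f[of n] by (intro mult_right_mono) auto
    also have "\<dots> = cmod (\<mu> - z n) * (norm p * (1 / (real n + 1)))"
      by (simp add: e_def)
    finally show "cmod (cinner (x n) p) \<le> norm p * (1 / (real n + 1))"
      by (rule mult_left_le_imp_le) (use z[of n] in auto)
  qed
  have "weakly_null x"
    unfolding weakly_null_def
  proof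
    fix w
    \<comment> \<open>Every \<open>w\<close> splits into a part in the closed range and a part in
      the kernel, the two cases just treated.\<close>
    obtain q where q: "q \<in> closure (ran_minus T \<mu>)" "w - q \<in> orth (closure (ran_minus T \<mu>))"
      using orth_projection_exists[OF subspace_closure[OF subspace_ran_minus[OF T(1)]] closed_closure] .
    have "(w - q, \<mu> *\<^sub>C (w - q)) \<in> T"
      using orth_ran_minus[OF T(2), of "w - q" \<mu>] q(2) \<mu> by (simp add: orth_closure)
    then have 1: "(\<lambda>n. cinner (x n) (w - q)) \<longlonglongrightarrow> 0"
      by (rule on_ker)
    have 2: "(\<lambda>n. cinner (x n) q) \<longlonglongrightarrow> 0"
      using weakly_null_on_closure[OF _ on_ran q(1)] x1 by simp
    show "(\<lambda>n. cinner (x n) w) \<longlonglongrightarrow> 0"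
      using tendsto_add[OF 1 2] by (simp add: cinner_diff_right)
  qed
  then show ?thesis
    unfolding has_singular_sequence_def using xf x1 lim0 by blast
qed

lemma singular_sequence_not_bounded_below:
  assumes "has_singular_sequence T \<mu>"
  shows "\<not> bounded_below_at T \<mu>"
proof
  assume "bounded_below_at T \<mu>"
  then obtain c where c: "c > 0" "\<And>x f. (x, f) \<in> T \<Longrightarrow> c * norm x \<le> norm (f - \<mu> *\<^sub>C x)"
    by (auto simp: bounded_below_at_def)
  obtain x f where xf: "\<And>n. (x n, f n) \<in> T" and x1: "\<And>n::nat. norm (x n) = 1"
    and lim: "(\<lambda>n. f n - \<mu> *\<^sub>C x n) \<longlonglongrightarrow> 0"
    using assms unfolding has_singular_sequence_def by blast
  have "c \<le> norm (f n - \<mu> *\<^sub>C x n)" for n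
    using c(2)[OF xf[of n]] x1[of n] by simp
  then have "c \<le> norm (0::'a)"
    by (intro LIMSEQ_le_const[OF tendsto_norm[OF lim]]) auto
  then show False
    using c(1) by simp
qed

text \<open>Otherwise the kernel components of the sequence are weakly null in finite dimension,
  hence norm null, and the components orthogonal to the kernel tend to 0 by the isolated-point
  bound; unit vectors cannot do that.\<close>

lemma singular_sequence_infinite_eigenspace:
  fixes T :: "('a::chilbert \<times> 'a) set"
  assumes T: "lin_rel T" "self_adjoint T" and sing: "has_singular_sequence T (complex_of_real s)"
    and isol: "\<not> complex_of_real s islimpt rspectrum T"
  shows "\<not> cfin_dim (eigenspace T (complex_of_real s))"
proof
  let ?\<mu> = "complex_of_real s"
  let ?E = "eigenspace T ?\<mu>"
  assume fin: "cfin_dim ?E"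
  obtain x f where xf: "\<And>n. (x n, f n) \<in> T" and x1: "\<And>n::nat. norm (x n) = 1"
    and lim: "(\<lambda>n. f n - ?\<mu> *\<^sub>C x n) \<longlonglongrightarrow> 0" and weak: "weakly_null x"
    using sing unfolding has_singular_sequence_def by blast
  obtain c where c: "c > 0"
    "\<And>x f. (x, f) \<in> T \<Longrightarrow> x \<in> orth ?E \<Longrightarrow> c * norm x \<le> norm (f - s *\<^sub>R x)"
    using isolated_bounded_below_orth_eigenspace[OF T isol] by metis
  have proj: "\<exists>p. p \<in> ?E \<and> w - p \<in> orth ?E" for w
    using orth_projection_exists[OF subspace_eigenspace[OF T(1)] closed_eigenspace[OF T(2)]] by metis
  then have "\<forall>n. \<exists>p. p \<in> ?E \<and> x n - p \<in> orth ?E"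
    by simp
  then obtain p where p: "\<And>n. p n \<in> ?E" "\<And>n. x n - p n \<in> orth ?E"
    by metis
  have "weakly_null p"
    unfolding weakly_null_def
  proof
    fix w
    obtain v where v: "v \<in> ?E" "w - v \<in> orth ?E"
      using proj by blast
    \<comment> \<open>The orthogonal projection is symmetric: projecting \<open>x n\<close> or
      \<open>w\<close> gives the same pairing.\<close>
    have "cinner (p n) w = cinner (x n) v" for n
    proof -
      have "cinner (p n) (w - v) = 0"
        using v(2) p(1) by (simp add: orth_def)
      moreover have "cinner (x n - p n) v = 0"
        using p(2) v(1) by (simp add: in_orth_iff)
      ultimately show ?thesis
        by (simp add: cinner_simps)
    qed
    then show "(\<lambda>n. cinner (p n) w) \<longlonglongrightarrow> 0"
      using weak by (simp add: weakly_null_def)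
  qed
  then have "p \<longlonglongrightarrow> 0"
    using weakly_null_finite_dim_tendsto[of p ?E] p(1) fin by blast
  moreover have "(\<lambda>n. x n - p n) \<longlonglongrightarrow> 0"
  proof (rule tendsto_of_bounded_by[OF _ tendsto_norm_zero[OF lim]])
    fix n
    \<comment> \<open>Subtracting an eigenvector pair leaves \<open>f n - \<mu> x n\<close>
      unchanged.\<close>
    have "(x n - p n, f n - ?\<mu> *\<^sub>C p n) \<in> T"
      using lin_rel_diff[OF T(1) xf[of n]] p(1)[of n] by (simp add: eigenspace_def)
    from c(2)[OF this p(2)] have "c * norm (x n - p n) \<le> norm (f n - ?\<mu> *\<^sub>C x n)"
      by (simp add: scaleC_of_real scaleR_diff_right)
    then show "norm (x n - p n) \<le> 1 / c * norm (f n - ?\<mu> *\<^sub>C x n)"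
      using c(1) by (simp add: field_simps)
  qed
  ultimately have "x \<longlonglongrightarrow> 0"
    using tendsto_add[of p 0 sequentially "\<lambda>n. x n - p n" 0] by simp
  then have "(\<lambda>n. norm (x n)) \<longlonglongrightarrow> 0"
    by (rule tendsto_norm_zero)
  then show False
    using x1 LIMSEQ_unique[of "\<lambda>n. norm (x n)" 0 1] by simp
qed

lemma infinite_eigenspace_singular_sequence:
  assumes "lin_rel T" "\<not> cfin_dim (eigenspace T \<mu>)"
  shows "has_singular_sequence T \<mu>"
proof -
  obtain e where "\<And>n. e n \<in> eigenspace T \<mu>" "\<And>n. norm (e n) = 1" "weakly_null e"
    using infinite_dim_weakly_null[OF subspace_eigenspace[OF assms(1)] assms(2)] by metis
  then show ?thesis
    unfolding has_singular_sequence_def eigenspace_def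
    by (intro exI[of _ e] exI[of _ "\<lambda>n. \<mu> *\<^sub>C e n"]) simp
qed

text \<open>Weyl's criterion. A limit point always has a singular sequence; at any other point a
  singular sequence exists exactly when the eigenspace is infinite-dimensional.\<close>

lemma ess_spectrum_iff_singular_sequence:
  fixes T :: "('a::chilbert \<times> 'a) set"
  assumes T: "lin_rel T" "self_adjoint T"
  shows "\<mu> \<in> ess_spectrum T \<longleftrightarrow> has_singular_sequence T \<mu>"
proof
  assume "\<mu> \<in> ess_spectrum T"
  then have "\<mu> \<in> rspectrum T" "\<mu> islimpt rspectrum T \<or> \<not> cfin_dim (eigenspace T \<mu>)"
    by (auto simp: ess_spectrum_def)
  then show "has_singular_sequence T \<mu>"
    using limit_point_singular_sequence[OF T rspectrum_real[OF T]]
      infinite_eigenspace_singular_sequence[OF T(1)] by blast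
next
  assume sing: "has_singular_sequence T \<mu>"
  then have spec: "\<mu> \<in> rspectrum T"
    using singular_sequence_not_bounded_below resolvent_set_iff_bounded_below[OF T]
    by (simp add: rspectrum_def)
  have "cnj \<mu> = \<mu>"
    using rspectrum_real[OF T spec] .
  then have "Im \<mu> = 0"
    by (simp add: complex_eq_iff)
  then have \<mu>: "\<mu> = complex_of_real (Re \<mu>)"
    by (simp add: complex_eq_iff)
  have inf: "\<not> cfin_dim (eigenspace T \<mu>)" if "\<not> \<mu> islimpt rspectrum T"
    using singular_sequence_infinite_eigenspace[OF T, of "Re \<mu>"] sing that \<mu> by metis
  moreover have "is_eigenvalue T \<mu>" if "\<not> cfin_dim (eigenspace T \<mu>)"
  proof (rule ccontr)
    assume "\<not> is_eigenvalue T \<mu>"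
    then have "eigenspace T \<mu> \<subseteq> cvec.span {}"
      by (auto simp: is_eigenvalue_def eigenspace_def)
    then show False
      using that unfolding cfin_dim_def by blast
  qed
  ultimately show "\<mu> \<in> ess_spectrum T"
    using spec by (auto simp: ess_spectrum_def)
qed

section \<open>Relatively compact perturbations\<close>

text \<open>Compactness is stated by sequences with arbitrary representatives \<open>v n\<close> in
  \<open>S(u n)\<close>, so the operator part of \<open>S\<close> does not appear. Linearity of
  \<open>K\<close> on \<open>D(S)\<close> is derived from symmetry and
  \<open>K_orth\<close>.\<close>

locale rel_compact_perturbation =
  fixes S :: "('a::chilbert \<times> 'a) set" and K :: "'a \<Rightarrow> 'a"
  assumes lin: "lin_rel S" and sa: "self_adjoint S"
    and K_orth: "x \<in> rdom S \<Longrightarrow> K x \<in> orth (rapp S 0)"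
    and K_sym: "x \<in> rdom S \<Longrightarrow> y \<in> rdom S \<Longrightarrow> cinner (K x) y = cinner x (K y)"
    and K_compact: "(\<And>n. (u n, v n) \<in> S) \<Longrightarrow> (\<And>n. norm (u n) \<le> C) \<Longrightarrow> (\<And>n. norm (v n) \<le> C)
      \<Longrightarrow> \<exists>r k. strict_mono (r :: nat \<Rightarrow> nat) \<and> (\<lambda>n. K (u (r n))) \<longlonglongrightarrow> k"
begin

definition perturbed :: "('a \<times> 'a) set" where
  "perturbed = {(x, f + K x) | x f. (x, f) \<in> S}"

lemma rdomI: "(x, f) \<in> S \<Longrightarrow> x \<in> rdom S"
  by (auto simp: rdom_def)

text \<open>A vector orthogonal to \<open>D(S)\<close> pairs with 0 to an element of the adjoint of
  \<open>S\<close>, so it lies in \<open>S(0)\<close>.\<close>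

lemma orth_dense:
  assumes "v \<in> orth (rapp S 0)" "\<And>y. y \<in> rdom S \<Longrightarrow> cinner v y = 0"
  shows "v = 0"
proof -
  have "(0, v) \<in> S"
    using assms(2) rdomI by (intro self_adjoint_memI[OF sa]) simp
  then have "v \<in> rapp S 0"
    by (simp add: rapp_def)
  then show ?thesis
    using assms(1) orth_inter_self by blast
qed

lemma rdom_add: "x \<in> rdom S \<Longrightarrow> y \<in> rdom S \<Longrightarrow> x + y \<in> rdom S"
  using lin_rel_add[OF lin] unfolding rdom_def by blast

lemma rdom_scale: "x \<in> rdom S \<Longrightarrow> c *\<^sub>C x \<in> rdom S"
  using lin_rel_scale[OF lin] unfolding rdom_def by blast

lemma K_add:
  assumes "x \<in> rdom S" "y \<in> rdom S"
  shows "K (x + y) = K x + K y"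
proof -
  \<comment> \<open>Symmetry moves \<open>K\<close> to the test vector, where additivity is that of
    the inner product.\<close>
  have "K (x + y) - (K x + K y) = 0"
  proof (rule orth_dense)
    show "K (x + y) - (K x + K y) \<in> orth (rapp S 0)"
      by (intro cvec.subspace_diff[OF subspace_orth] cvec.subspace_add[OF subspace_orth] K_orth rdom_add assms)
    show "cinner (K (x + y) - (K x + K y)) z = 0" if "z \<in> rdom S" for z
      using K_sym[OF rdom_add[OF assms] that] K_sym[OF assms(1) that] K_sym[OF assms(2) that] by (simp add: cinner_diff_left cinner_add_left)
  qed
  then show ?thesis
    by simp
qed

lemma K_scale:
  assumes "x \<in> rdom S"
  shows "K (c *\<^sub>C x) = c *\<^sub>C K x"
proof -
  have "K (c *\<^sub>C x) - c *\<^sub>C K x = 0"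
  proof (rule orth_dense)
    show "K (c *\<^sub>C x) - c *\<^sub>C K x \<in> orth (rapp S 0)"
      by (intro cvec.subspace_diff[OF subspace_orth] cvec.subspace_scale[OF subspace_orth] K_orth rdom_scale assms)
    show "cinner (K (c *\<^sub>C x) - c *\<^sub>C K x) z = 0" if "z \<in> rdom S" for z
      using K_sym[OF rdom_scale[OF assms] that] K_sym[OF assms that] by (simp add: cinner_diff_left cinner_scaleC_left)
  qed
  then show ?thesis
    by simp
qed

lemma K_diff:
  assumes "x \<in> rdom S" "y \<in> rdom S"
  shows "K (x - y) = K x - K y"
  using K_add[OF assms(1) rdom_scale[OF assms(2), of "- 1"]] K_scale[OF assms(2), of "- 1"] by simp

lemma K_zero: "K 0 = 0"
  using K_scale[OF rdomI[OF lin_rel_zero[OF lin]], of 0] by simp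

text \<open>Against \<open>y\<close> in \<open>D(S)\<close> the limit pairs to the limit of
  \<open>cinner (u n) (K y)\<close>, which is 0.\<close>

lemma K_limit_zero:
  assumes "\<And>n. u n \<in> rdom S" "(\<lambda>n. K (u n)) \<longlonglongrightarrow> k"
    and weak: "\<And>w. (\<lambda>n. cinner (u n) w) \<longlonglongrightarrow> 0"
  shows "k = 0"
proof (rule orth_dense)
  show "k \<in> orth (rapp S 0)"
    by (rule closed_sequentially[OF closed_orth _ assms(2)]) (rule K_orth[OF assms(1)])
  fix y assume "y \<in> rdom S"
  then have "cinner (K (u n)) y = cinner (u n) (K y)" for n
    by (rule K_sym[OF assms(1)])
  then have "(\<lambda>n. cinner (u n) (K y)) \<longlonglongrightarrow> cinner k y"
    using tendsto_cinner_left[OF assms(2), of y] by simp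
  then show "cinner k y = 0"
    using weak LIMSEQ_unique by blast
qed

text \<open>A counterexample sequence, scaled to \<open>norm (K (u n)) = 1\<close>, has
  \<open>u n\<close> tending to 0 and \<open>v n\<close> bounded. A limit of \<open>K (u n)\<close>
  along a subsequence would have norm 1 and be 0.\<close>

lemma K_relative_bound:
  assumes "e > 0"
  obtains C where "C \<ge> 0" "\<And>x f. (x, f) \<in> S \<Longrightarrow> norm (K x) \<le> e * norm f + C * norm x"
proof -
  have "\<exists>C\<ge>0. \<forall>x f. (x, f) \<in> S \<longrightarrow> norm (K x) \<le> e * norm f + C * norm x"
  proof (rule ccontr)
    assume "\<not> ?thesis"
    then have "\<exists>x f. (x, f) \<in> S \<and> norm (K x) > e * norm f + (real n + 1) * norm x" for n
      by (metis add_nonneg_nonneg not_le of_nat_0_le_iff zero_le_one)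
    then obtain x f where xf: "\<And>n. (x n, f n) \<in> S"
      and big: "\<And>n. norm (K (x n)) > e * norm (f n) + (real n + 1) * norm (x n)"
      by metis
    have pos: "norm (K (x n)) > 0" for n
    proof -
      have "0 \<le> e * norm (f n) + (real n + 1) * norm (x n)"
        using \<open>e > 0\<close> by simp
      then show ?thesis
        using big[of n] by linarith
    qed
    define c where "c = (\<lambda>n. complex_of_real (1 / norm (K (x n))))"
    have nc: "cmod (c n) = 1 / norm (K (x n))" for n
      by (simp add: c_def norm_divide)
    define u where "u = (\<lambda>n. c n *\<^sub>C x n)"
    define v where "v = (\<lambda>n. c n *\<^sub>C f n)"
    have uv: "(u n, v n) \<in> S" for n
      unfolding u_def v_def by (rule lin_rel_scale[OF lin xf])
    have Ku: "norm (K (u n)) = 1" for n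
      using pos[of n] by (simp add: u_def K_scale[OF rdomI[OF xf]] norm_scaleC nc)
    have sm: "e * norm (v n) + (real n + 1) * norm (u n) < 1" for n
      using big[of n] pos[of n] by (simp add: u_def v_def norm_scaleC nc field_simps)
    have u_small: "norm (u n) \<le> 1 * (1 / (real n + 1))" for n
    proof -
      have "(real n + 1) * norm (u n) \<le> 1"
        using sm[of n] mult_nonneg_nonneg[of e "norm (v n)"] \<open>e > 0\<close> norm_ge_zero[of "v n"] by linarith
      then show ?thesis
        by (simp add: field_simps)
    qed
    have v_small: "norm (v n) \<le> 1 / e" for n
    proof -
      have "e * norm (v n) \<le> 1"
        using sm[of n] mult_nonneg_nonneg[of "real n + 1" "norm (u n)"] norm_ge_zero[of "u n"] by linarith
      then show ?thesis
        using \<open>e > 0\<close> by (simp add: field_simps)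
    qed
    have "(\<lambda>n. 1 / (real n + 1)) \<longlonglongrightarrow> 0"
      using LIMSEQ_Suc[OF lim_inverse_n'] by (simp add: add.commute)
    then have u0: "u \<longlonglongrightarrow> 0"
      by (rule tendsto_of_bounded_by[OF u_small])
    have u_le: "norm (u n) \<le> 1" for n
    proof -
      have "1 / (real n + 1) \<le> 1"
        by simp
      then show ?thesis
        using u_small[of n] by linarith
    qed
    have "\<exists>r k. strict_mono (r :: nat \<Rightarrow> nat) \<and> (\<lambda>n. K (u (r n))) \<longlonglongrightarrow> k"
    proof (rule K_compact[OF uv])
      \<comment> \<open>\<open>K_compact\<close> takes one bound for both components, hence the
        maximum.\<close>
      show "norm (u n) \<le> max 1 (1 / e)" "norm (v n) \<le> max 1 (1 / e)" for n
        using u_le[of n] v_small[of n] by (simp_all add: le_max_iff_disj)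
    qed
    then obtain r k where r: "strict_mono (r :: nat \<Rightarrow> nat)" and k: "(\<lambda>n. K (u (r n))) \<longlonglongrightarrow> k"
      by blast
    have "(\<lambda>n. u (r n)) \<longlonglongrightarrow> 0"
      using LIMSEQ_subseq_LIMSEQ[OF u0 r] by (simp add: o_def)
    then have "k = 0"
      using K_limit_zero[OF rdomI[OF uv] k] tendsto_cinner_left[of "\<lambda>n. u (r n)" 0] by simp
    moreover have "(\<lambda>n. norm (K (u (r n)))) \<longlonglongrightarrow> norm k"
      using k by (rule tendsto_norm)
    then have "norm k = 1"
      using Ku LIMSEQ_unique[of "\<lambda>n. norm (K (u (r n)))" "norm k" 1] by simp
    ultimately show False
      by simp
  qed
  then show ?thesis
    using that by blast
qed

section \<open>Self-adjointness of the perturbed relation\<close>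

lemma perturbed_mem: "(x, g) \<in> perturbed \<longleftrightarrow> (x, g - K x) \<in> S"
  unfolding perturbed_def by (auto intro!: exI[of _ "g - K x"])

lemma lin_rel_perturbed: "lin_rel perturbed"
  unfolding lin_rel_def perturbed_mem
proof (intro conjI allI impI)
  show "(0, 0 - K 0) \<in> S"
    using lin_rel_zero[OF lin] by (simp add: K_zero)
next
  fix x f y g assume a: "(x, f - K x) \<in> S \<and> (y, g - K y) \<in> S"
  then have "K (x + y) = K x + K y"
    by (intro K_add) (auto intro: rdomI)
  then show "(x + y, f + g - K (x + y)) \<in> S"
    using lin_rel_add[OF lin, of x "f - K x" y "g - K y"] a by (simp add: add_diff_add)
next
  fix c x f assume a: "(x, f - K x) \<in> S"
  show "(c *\<^sub>C x, c *\<^sub>C f - K (c *\<^sub>C x)) \<in> S"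
    using lin_rel_scale[OF lin a, of c] K_scale[OF rdomI[OF a], of c]
    by (simp add: cvec.scale_right_diff_distrib)
qed

lemma hermitian_perturbed: "hermitian perturbed"
  unfolding hermitian_def radj_def
proof (clarify)
  fix y g x f assume "(y, g) \<in> perturbed" "(x, f) \<in> perturbed"
  then have yg: "(y, g - K y) \<in> S" and xf: "(x, f - K x) \<in> S"
    by (simp_all add: perturbed_mem)
  show "cinner g x = cinner y f"
    using hermitian_cinner_eq[OF self_adjoint_imp_hermitian[OF sa] xf yg]
      K_sym[OF rdomI[OF yg] rdomI[OF xf]]
    by (simp add: cinner_diff_left cinner_diff_right)
qed

text \<open>With \<open>X\<close> the resolvent of \<open>S\<close> at \<open>it\<close>, the
  equation becomes \<open>u + K (X u) = y\<close>, a fixed point problem.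
  \<open>norm (X u) \<le> norm u / \<bar>t\<bar>\<close> and the corresponding element of
  \<open>S(X u)\<close> has norm at most \<open>2 * norm u\<close>, so the contraction factor is
  \<open>1/4 * 2 + C / \<bar>t\<bar> \<le> 3/4\<close>.\<close>

lemma perturbed_surj:
  assumes t: "\<bar>t\<bar> \<ge> 4 * C" "t \<noteq> 0" "C \<ge> 0"
    and bound: "\<And>x f. (x, f) \<in> S \<Longrightarrow> norm (K x) \<le> 1 / 4 * norm f + C * norm x"
  obtains x g where "(x, g) \<in> perturbed" "g - Complex 0 t *\<^sub>C x = y"
proof -
  let ?z = "Complex 0 t"
  have herm: "hermitian S"
    using sa self_adjoint_imp_hermitian by blast
  have "\<exists>x. (x, u + ?z *\<^sub>C x) \<in> S" for u
  proof -
    obtain x f where "(x, f) \<in> S" "f - ?z *\<^sub>C x = u"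
      using bounded_below_surj[OF lin sa bounded_below_nonreal[OF herm] bounded_below_nonreal[OF herm], of ?z]
        t(2) by auto
    then show ?thesis
      by (metis diff_add_cancel)
  qed
  then obtain X where X: "\<And>u. (X u, u + ?z *\<^sub>C X u) \<in> S"
    by metis
  have "\<exists>!u. y - K (X u) = u"
  proof (rule banach_fix_type[of "3 / 4"])
    show "\<forall>u v. dist (y - K (X u)) (y - K (X v)) \<le> 3 / 4 * dist u v"
    proof (intro allI)
      fix u v
      define d where "d = X u - X v"
      define f where "f = (u + ?z *\<^sub>C X u) - (v + ?z *\<^sub>C X v)"
      have df: "(d, f) \<in> S"
        unfolding d_def f_def by (rule lin_rel_diff[OF lin X X])
      have uv: "f - ?z *\<^sub>C d = u - v"
        by (simp add: f_def d_def cvec.scale_right_diff_distrib)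
      have td: "\<bar>t\<bar> * norm d \<le> norm (u - v)"
        using hermitian_nonreal_bound[OF herm df, of ?z] by (simp add: uv)
      have "f = (u - v) + ?z *\<^sub>C d"
        by (simp flip: uv)
      then have "norm f \<le> norm (u - v) + norm (?z *\<^sub>C d)"
        by (simp only: norm_triangle_ineq)
      also have "norm (?z *\<^sub>C d) = \<bar>t\<bar> * norm d"
        by (simp add: norm_scaleC complex_norm)
      finally have nf: "norm f \<le> 2 * norm (u - v)"
        using td by linarith
      have "4 * C * norm d \<le> \<bar>t\<bar> * norm d"
        using t(1) by (intro mult_right_mono) auto
      then have "C * norm d \<le> 1 / 4 * norm (u - v)"
        using td by linarith
      then have "norm (K d) \<le> 3 / 4 * norm (u - v)"
        using bound[OF df] nf by linarith
      moreover have "K d = K (X u) - K (X v)"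
        unfolding d_def by (rule K_diff[OF rdomI[OF X] rdomI[OF X]])
      ultimately show "dist (y - K (X u)) (y - K (X v)) \<le> 3 / 4 * dist u v"
        by (simp add: dist_norm norm_minus_commute)
    qed
  qed auto
  then obtain u where "y - K (X u) = u"
    by blast
  then have u: "u + K (X u) = y"
    by (metis diff_add_cancel)
  show ?thesis
  proof (rule that)
    show "(X u, u + ?z *\<^sub>C X u + K (X u)) \<in> perturbed"
      using X[of u] by (simp add: perturbed_mem)
    show "u + ?z *\<^sub>C X u + K (X u) - ?z *\<^sub>C X u = y"
      using u by simp
  qed
qed

text \<open>The Kato-Rellich argument: a Hermitian relation is self-adjoint as soon as \<open>T - it\<close> and
  \<open>T + it\<close> are both onto.\<close>
lemma self_adjoint_perturbed: "self_adjoint perturbed"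
proof -
  obtain C where C: "C \<ge> 0" "\<And>x f. (x, f) \<in> S \<Longrightarrow> norm (K x) \<le> 1 / 4 * norm f + C * norm x"
    using K_relative_bound[of "1 / 4"] by auto
  \<comment> \<open>The summand 1 keeps \<open>t\<close> nonzero when \<open>C = 0\<close>.\<close>
  define t where "t = 4 * C + 1"
  have t: "\<bar>t\<bar> \<ge> 4 * C" "t \<noteq> 0" "\<bar>- t\<bar> \<ge> 4 * C" "- t \<noteq> 0"
    using C(1) by (auto simp: t_def)
  let ?z = "Complex 0 t"
  have "(y, g) \<in> perturbed" if yg: "(y, g) \<in> radj perturbed" for y g
  proof -
    \<comment> \<open>\<open>(x, f)\<close> has the same image under \<open>T - it\<close> as the
      adjoint element \<open>(y, g)\<close>; it remains to show \<open>x = y\<close>.\<close>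
    obtain x f where xf: "(x, f) \<in> perturbed" "f - ?z *\<^sub>C x = g - ?z *\<^sub>C y"
      using perturbed_surj[OF t(1,2) C, of "g - ?z *\<^sub>C y"] by blast
    obtain a b where ab: "(a, b) \<in> perturbed" "b - Complex 0 (- t) *\<^sub>C a = y - x"
      using perturbed_surj[OF t(3,4) C, of "y - x"] by blast
    have "cinner g a = cinner y b"
      using yg ab(1) by (auto simp: radj_def)
    moreover have "cinner f a = cinner x b"
      using hermitian_cinner_eq[OF hermitian_perturbed ab(1) xf(1)] .
    ultimately have 1: "cinner (g - f) a = cinner (y - x) b"
      by (simp add: cinner_diff_left)
    have gf: "g - f = ?z *\<^sub>C (y - x)"
      using xf(2) by (simp add: cvec.scale_right_diff_distrib algebra_simps)
    \<comment> \<open>Since \<open>y - x = b + i t a\<close>, pairing \<open>y - x\<close> with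
      itself reduces to the adjoint identity \<open>1\<close> and vanishes.\<close>
    have "cnj (Complex 0 (- t)) = ?z"
      by (simp add: complex_eq_iff)
    then have "cinner (y - x) (b - Complex 0 (- t) *\<^sub>C a) = cinner (y - x) b - ?z * cinner (y - x) a"
      by (simp only: cinner_diff_right cinner_scaleC_right)
    also have "\<dots> = 0"
      using 1 by (simp add: gf cinner_scaleC_left)
    finally have "y - x = 0"
      using ab(2) cinner_eq_zero_iff by metis
    then show ?thesis
      using xf gf by simp
  qed
  then have "radj perturbed \<subseteq> perturbed"
    by auto
  then show ?thesis
    using hermitian_perturbed unfolding hermitian_def self_adjoint_def by blast
qed

lemma singular_sequence_perturbed:
  assumes "has_singular_sequence S \<mu>"
  shows "has_singular_sequence perturbed \<mu>"
proof -
  obtain x f where xf: "\<And>n. (x n, f n) \<in> S" and x1: "\<And>n. norm (x n) = 1"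
    and lim: "(\<lambda>n. f n - \<mu> *\<^sub>C x n) \<longlonglongrightarrow> 0" and weak: "weakly_null x"
    using assms unfolding has_singular_sequence_def by blast
  obtain B where B: "\<And>n. norm (f n - \<mu> *\<^sub>C x n) \<le> B"
    using convergent_imp_Bseq[OF convergentI[OF lim]] by (auto simp: Bseq_def)
  have "\<exists>r k. strict_mono (r :: nat \<Rightarrow> nat) \<and> (\<lambda>n. K (x (r n))) \<longlonglongrightarrow> k"
  proof (rule K_compact[OF xf])
    fix n
    \<comment> \<open>A singular sequence is bounded in the graph norm.\<close>
    have "f n = (f n - \<mu> *\<^sub>C x n) + \<mu> *\<^sub>C x n"
      by simp
    then have "norm (f n) \<le> norm (f n - \<mu> *\<^sub>C x n) + norm (\<mu> *\<^sub>C x n)"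
      using norm_triangle_ineq by metis
    then have "norm (f n) \<le> B + cmod \<mu>"
      using B[of n] by (simp add: norm_scaleC x1)
    then show "norm (f n) \<le> max 1 (B + cmod \<mu>)"
      by simp
    show "norm (x n) \<le> max 1 (B + cmod \<mu>)"
      by (simp add: x1)
  qed
  then obtain r k where r: "strict_mono (r :: nat \<Rightarrow> nat)" and k: "(\<lambda>n. K (x (r n))) \<longlonglongrightarrow> k"
    by blast
  have weak_r: "(\<lambda>n. cinner (x (r n)) w) \<longlonglongrightarrow> 0" for w
    using LIMSEQ_subseq_LIMSEQ[OF _ r, of "\<lambda>n. cinner (x n) w" 0] weak
    by (simp add: weakly_null_def o_def)
  then have "k = 0"
    by (rule K_limit_zero[OF rdomI[OF xf] k])
  have "(\<lambda>n. f (r n) - \<mu> *\<^sub>C x (r n)) \<longlonglongrightarrow> 0"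
    using LIMSEQ_subseq_LIMSEQ[OF lim r] by (simp add: o_def)
  from tendsto_add[OF this k] have "(\<lambda>n. (f (r n) + K (x (r n))) - \<mu> *\<^sub>C x (r n)) \<longlonglongrightarrow> 0"
    using \<open>k = 0\<close> by (simp add: algebra_simps)
  moreover have "(x (r n), f (r n) + K (x (r n))) \<in> perturbed" for n
    by (simp add: perturbed_mem xf)
  moreover have "weakly_null (\<lambda>n. x (r n))"
    using weak_r by (simp add: weakly_null_def)
  ultimately show ?thesis
    unfolding has_singular_sequence_def using x1
    by (intro exI[of _ "\<lambda>n. x (r n)"] exI[of _ "\<lambda>n. f (r n) + K (x (r n))"]) simp
qed

lemma rdom_perturbed: "rdom perturbed = rdom S"
  by (auto simp: rdom_def perturbed_def)

lemma rapp_perturbed_zero: "rapp perturbed 0 = rapp S 0"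
  by (simp add: rapp_def perturbed_mem K_zero)

text \<open>Lets \<open>S\<close> be treated as a perturbation of \<open>perturbed\<close>. The
  relative bound 1/2 turns boundedness in the graph norm of \<open>perturbed\<close> into
  boundedness in that of \<open>S\<close>.\<close>

lemma perturbed_inverse: "rel_compact_perturbation perturbed (\<lambda>x. - K x)"
proof
  show "lin_rel perturbed" "self_adjoint perturbed"
    by (fact lin_rel_perturbed, fact self_adjoint_perturbed)
  show "- K x \<in> orth (rapp perturbed 0)" if "x \<in> rdom perturbed" for x
    using that unfolding rdom_perturbed rapp_perturbed_zero
    by (intro cvec.subspace_neg[OF subspace_orth] K_orth)
  show "cinner (- K x) y = cinner x (- K y)" if "x \<in> rdom perturbed" "y \<in> rdom perturbed" for x y
    using that K_sym[of x y] cinner_diff_left[of 0 "K x" y] cinner_diff_right[of x 0 "K y"]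
    by (simp add: rdom_perturbed)
  fix u v :: "nat \<Rightarrow> 'a" and B
  assume uv: "\<And>n. (u n, v n) \<in> perturbed" and u: "\<And>n. norm (u n) \<le> B" and v: "\<And>n. norm (v n) \<le> B"
  obtain C where C: "C \<ge> 0" "\<And>x f. (x, f) \<in> S \<Longrightarrow> norm (K x) \<le> 1 / 2 * norm f + C * norm x"
    using K_relative_bound[of "1 / 2"] by auto
  have uv': "(u n, v n - K (u n)) \<in> S" for n
    using uv by (simp add: perturbed_mem)
  \<comment> \<open>\<open>norm (v n - K (u n))\<close> is at most \<open>B + C * B\<close> plus
    half of itself; the half is absorbed.\<close>
  have bound: "norm (v n - K (u n)) \<le> 2 * B + 2 * (C * B)" for n
  proof -
    have "norm (v n - K (u n)) \<le> norm (v n) + norm (K (u n))"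
      by (rule norm_triangle_ineq4)
    moreover have "C * norm (u n) \<le> C * B"
      using u C(1) by (rule mult_left_mono)
    ultimately show ?thesis
      using C(2)[OF uv'[of n]] v[of n] by linarith
  qed
  have "\<exists>r k. strict_mono (r :: nat \<Rightarrow> nat) \<and> (\<lambda>n. K (u (r n))) \<longlonglongrightarrow> k"
  proof (rule K_compact[OF uv'])
    show "norm (u n) \<le> max B (2 * B + 2 * (C * B))" "norm (v n - K (u n)) \<le> max B (2 * B + 2 * (C * B))" for n
      using u[of n] bound[of n] by simp_all
  qed
  then show "\<exists>r k. strict_mono (r :: nat \<Rightarrow> nat) \<and> (\<lambda>n. - K (u (r n))) \<longlonglongrightarrow> k"
    using tendsto_minus by blast
qed

lemma ess_spectrum_perturbed: "ess_spectrum perturbed = ess_spectrum S"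
proof -
  interpret inv: rel_compact_perturbation perturbed "\<lambda>x. - K x"
    by (rule perturbed_inverse)
  have "inv.perturbed = S"
    by (auto simp: inv.perturbed_mem perturbed_mem)
  then have "has_singular_sequence perturbed \<mu> \<longleftrightarrow> has_singular_sequence S \<mu>" for \<mu>
    using singular_sequence_perturbed inv.singular_sequence_perturbed by metis
  then show ?thesis
    using ess_spectrum_iff_singular_sequence[OF lin sa]
      ess_spectrum_iff_singular_sequence[OF lin_rel_perturbed self_adjoint_perturbed] by blast
qed

end

section \<open>From the relation \<open>A\<close> to the operator \<open>K\<close>\<close>

lemma cproj_eqI:
  assumes M: "cvec.subspace M" and y: "y \<in> M" "x - y \<in> orth M"
  shows "cproj M x = y"
  unfolding cproj_def
proof (rule the_equality)
  fix z assume z: "z \<in> M \<and> x - z \<in> orth M"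
  have "z - y \<in> M"
    using cvec.subspace_diff[OF M] z y(1) by blast
  moreover have "(x - y) - (x - z) \<in> orth M"
    using cvec.subspace_diff[OF subspace_orth] z y(2) by blast
  then have "z - y \<in> orth M"
    by simp
  ultimately have "z - y = 0"
    by (rule orth_inter_self)
  then show "z = y"
    by simp
qed (use y in simp)

text \<open>The projection onto the complement is the residual of the projection onto
  \<open>M\<close>.\<close>

lemma cproj_orth:
  fixes M :: "'a::chilbert set"
  assumes M: "cvec.subspace M" "closed M"
  shows "cproj (orth M) w \<in> orth M" "w - cproj (orth M) w \<in> M"
proof -
  obtain q where q: "q \<in> M" "w - q \<in> orth M"
    using orth_projection_exists[OF M] .
  have "q \<in> orth (orth M)"
    using q(1) unfolding orth_def[of "orth M"] by (simp add: in_orth_iff)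
  then have "cproj (orth M) w = w - q"
    using q(2) by (intro cproj_eqI subspace_orth) simp_all
  then show "cproj (orth M) w \<in> orth M" "w - cproj (orth M) w \<in> M"
    using q by simp_all
qed

lemma subspace_rapp_zero: "lin_rel T \<Longrightarrow> cvec.subspace (rapp T 0)"
  using lin_rel_zero[of T] lin_rel_add[of T 0 _ 0] lin_rel_scale[of T 0]
  by (auto simp: cvec.subspace_def rapp_def)

lemma closed_rapp_zero:
  assumes "self_adjoint T"
  shows "closed (rapp T 0)"
  unfolding closed_sequential_limits rapp_def mem_Collect_eq
proof (intro allI impI)
  fix u l assume "(\<forall>n. (0, u n) \<in> T) \<and> u \<longlonglongrightarrow> l"
  then show "(0, l) \<in> T"
    using self_adjoint_limit[OF assms, of "\<lambda>_. 0" u 0 l] by simp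
qed

lemma rdom_subset_orth_rapp_zero:
  assumes "hermitian T"
  shows "rdom T \<subseteq> orth (rapp T 0)"
  using hermitian_cinner_eq[OF assms, of _ _ 0] by (auto simp: rdom_def rapp_def orth_def)

text \<open>Pairing with \<open>(0, g)\<close> only sees second components, so \<open>rel_s\<close>
  consists of the pairs with second entry orthogonal to \<open>T(0)\<close>.\<close>

lemma rel_sD:
  assumes "(x, f) \<in> rel_s T"
  shows "(x, f) \<in> T" "f \<in> orth (rapp T 0)"
  using assms by (auto simp: rel_s_def rel_inf_def pinner_def rapp_def in_orth_iff)

lemma rel_sI:
  assumes "(x, f) \<in> T" "f \<in> orth (rapp T 0)"
  shows "(x, f) \<in> rel_s T"
  using assms by (auto simp: rel_s_def rel_inf_def pinner_def rapp_def in_orth_iff)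

text \<open>Each value in \<open>A(x)\<close> differs from \<open>K x\<close> by an element of
  \<open>M = S(0)\<close>: \<open>Q\<close> removes a component in \<open>M\<close>, and two values
  of \<open>A\<close> at \<open>x\<close> differ by an element of \<open>A(0)\<close>, which is
  contained in \<open>M\<close>. Such differences are absorbed by \<open>S(x)\<close>.\<close>

lemma perturbation_by_relation:
  fixes S A :: "('a::chilbert \<times> 'a) set"
  assumes S: "lin_rel S" "self_adjoint S" and A: "lin_rel A" "hermitian A" and dom: "rdom S \<subseteq> rdom A"
    and cpt: "rel_compact (rcomp_map (cproj (orth (rapp S 0))) (rel_s A)) (rel_s S)"
  obtains K where "rel_compact_perturbation S K" "rsum S A = rel_compact_perturbation.perturbed S K"
proof -
  define M where "M = rapp S 0"
  define P where "P = cproj (orth M)"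
  define U where "U = rcomp_map P (rel_s A)"
  have cptU: "rel_compact U (rel_s S)"
    using cpt by (simp add: U_def P_def M_def)
  have M: "cvec.subspace M" "closed M"
    unfolding M_def by (rule subspace_rapp_zero[OF S(1)], rule closed_rapp_zero[OF S(2)])
  have P: "P w \<in> orth M" "w - P w \<in> M" for w
    unfolding P_def by (rule cproj_orth[OF M])+
  have M_iff: "g \<in> M \<longleftrightarrow> (0, g) \<in> S" for g
    by (simp add: M_def rapp_def)
  have dom_orth: "rdom S \<subseteq> orth M"
    unfolding M_def by (rule rdom_subset_orth_rapp_zero[OF self_adjoint_imp_hermitian[OF S(2)]])
  have shift: "(x, f + g) \<in> S" if "(x, f) \<in> S" "g \<in> M" for x f g
    using lin_rel_add[OF S(1) that(1), of 0 g] that(2) by (simp add: M_iff)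
  \<comment> \<open>A value of \<open>Q A_s\<close> is chosen; it is genuine for \<open>x\<close> in
    \<open>D(S)\<close> by \<open>KU\<close> and arbitrary elsewhere.\<close>
  define K where "K = (\<lambda>x. SOME k. (x, k) \<in> U)"
  have KU: "(x, K x) \<in> U" if "x \<in> rdom S" for x
  proof -
    obtain f where f: "(x, f) \<in> S"
      using \<open>x \<in> rdom S\<close> by (auto simp: rdom_def)
    have "(x, P f) \<in> S"
      using shift[OF f, of "- (f - P f)"] cvec.subspace_neg[OF M(1) P(2)] by simp
    then have "(x, P f) \<in> rel_s S"
      using P(1) by (intro rel_sI) (simp_all add: M_def)
    then have "x \<in> rdom U"
      using cptU unfolding rel_compact_def rdom_def by blast
    then have "\<exists>k. (x, k) \<in> U"
      by (simp add: rdom_def)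
    then show ?thesis
      unfolding K_def by (rule someI_ex)
  qed
  have K_ex: "\<exists>h. (x, h) \<in> A \<and> K x = P h" if "x \<in> rdom S" for x
    using KU[OF that] rel_sD(1) unfolding U_def rcomp_map_def by blast
  have A0: "a \<in> M" if "(0, a) \<in> A" for a
    unfolding M_iff
  proof (rule self_adjoint_memI[OF S(2)])
    fix y f assume "(y, f) \<in> S"
    then obtain b where "(y, b) \<in> A"
      using dom by (auto simp: rdom_def)
    then show "cinner a y = cinner 0 f"
      using hermitian_cinner_eq[OF A(2) _ that, of y b] by simp
  qed
  \<comment> \<open>\<open>D(S)\<close> is orthogonal to \<open>M\<close>, so the projection
    disappears in pairings with it and \<open>K\<close> inherits symmetry from
    \<open>A\<close>.\<close>
  have P_left: "cinner (P h) y = cinner h y" and P_right: "cinner y (P h) = cinner y h"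
    if "y \<in> rdom S" for y h
  proof -
    have y: "y \<in> orth M"
      using dom_orth that by blast
    have "cinner (h - P h) y = 0"
      using y P(2)[of h] by (simp add: orth_def)
    then show "cinner (P h) y = cinner h y"
      by (simp add: cinner_diff_left)
    have "cinner y (h - P h) = 0"
      using y P(2)[of h] by (simp add: in_orth_iff)
    then show "cinner y (P h) = cinner y h"
      by (simp add: cinner_diff_right)
  qed
  have pert: "rel_compact_perturbation S K"
  proof
    show "lin_rel S" "self_adjoint S"
      by (fact S)+
    show "K x \<in> orth (rapp S 0)" if "x \<in> rdom S" for x
      using K_ex[OF that] P(1) by (auto simp: M_def)
    show "cinner (K x) y = cinner x (K y)" if x: "x \<in> rdom S" and y: "y \<in> rdom S" for x y
    proof -
      obtain h h' where "(x, h) \<in> A" "K x = P h" "(y, h') \<in> A" "K y = P h'"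
        using K_ex[OF x] K_ex[OF y] by blast
      then show ?thesis
        using hermitian_cinner_eq[OF A(2), of y h' x h] P_left[OF y] P_right[OF x] by simp
    qed
    fix u v :: "nat \<Rightarrow> 'a" and C
    assume uv: "\<And>n. (u n, v n) \<in> S" and u: "\<And>n. norm (u n) \<le> C" and v: "\<And>n. norm (v n) \<le> C"
    \<comment> \<open>\<open>f\<close> is the component of \<open>v n\<close> orthogonal to
      \<open>S(0)\<close>, so by Pythagoras its norm is at most that of \<open>v n\<close>.\<close>
    have "norm (u n) + norm f \<le> 2 * C" if f: "(u n, f) \<in> rel_s S" for n f
    proof -
      have "v n - f \<in> M"
        using lin_rel_diff[OF S(1) uv[of n] rel_sD(1)[OF f]] by (simp add: M_iff)
      then have "cinner f (v n - f) = 0"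
        using rel_sD(2)[OF f] by (simp add: M_def in_orth_iff)
      then have "(norm f)\<^sup>2 \<le> (norm (v n))\<^sup>2"
        using norm_add_square[of f "v n - f"] by simp
      then have "norm f \<le> norm (v n)"
        by (rule power2_le_imp_le) simp
      then show ?thesis
        using u[of n] v[of n] by linarith
    qed
    then have bd: "\<exists>C. \<forall>x\<in>range u. \<forall>f. (x, f) \<in> rel_s S \<longrightarrow> norm x + norm f \<le> C"
      by blast
    have "u n \<in> rdom (rel_s S)" for n
    proof -
      have "- (v n - P (v n)) \<in> M"
        using cvec.subspace_neg[OF M(1) P(2)] .
      then have "(u n, P (v n)) \<in> S"
        using shift[OF uv[of n], of "- (v n - P (v n))"] by simp
      then have "(u n, P (v n)) \<in> rel_s S"
        using P(1) by (intro rel_sI) (simp_all add: M_def)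
      then show ?thesis
        unfolding rdom_def by blast
    qed
    then have "range u \<subseteq> rdom (rel_s S)"
      by blast
    with bd have "compact (closure {f. \<exists>x\<in>range u. (x, f) \<in> U})"
      using cptU[unfolded rel_compact_def, THEN conjunct2, THEN spec, of "range u"] by simp
    then have seq: "seq_compact (closure {f. \<exists>x\<in>range u. (x, f) \<in> U})"
      by (simp add: compact_eq_seq_compact_metric)
    have mem: "K (u n) \<in> closure {f. \<exists>x\<in>range u. (x, f) \<in> U}" for n
    proof -
      have "u n \<in> rdom S"
        using uv[of n] by (auto simp: rdom_def)
      then have "(u n, K (u n)) \<in> U"
        by (rule KU)
      then have "K (u n) \<in> {f. \<exists>x\<in>range u. (x, f) \<in> U}"
        by (simp only: mem_Collect_eq) (rule bexI[OF _ rangeI])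
      then show ?thesis
        by (rule subsetD[OF closure_subset])
    qed
    from seq[unfolded seq_compact_def, THEN spec, of "\<lambda>n. K (u n)"] mem
    show "\<exists>r k. strict_mono (r :: nat \<Rightarrow> nat) \<and> (\<lambda>n. K (u (r n))) \<longlonglongrightarrow> k"
      by (auto simp: o_def)
  qed
  interpret rel_compact_perturbation S K
    by (rule pert)
  have "(x, w) \<in> rsum S A \<longleftrightarrow> (x, w - K x) \<in> S" for x w
  proof
    assume "(x, w) \<in> rsum S A"
    then obtain f a where f: "(x, f) \<in> S" and a: "(x, a) \<in> A" and w: "w = f + a"
      by (auto simp: rsum_def)
    obtain h where h: "(x, h) \<in> A" "K x = P h"
      using K_ex[OF rdomI[OF f]] by blast
    have "a - h \<in> M"
      using A0 lin_rel_diff[OF A(1) a h(1)] by simp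
    then have "(a - h) + (h - K x) \<in> M"
      using P(2)[of h] unfolding h(2) by (rule cvec.subspace_add[OF M(1)])
    from shift[OF f this] show "(x, w - K x) \<in> S"
      by (simp add: w algebra_simps)
  next
    assume f: "(x, w - K x) \<in> S"
    obtain h where h: "(x, h) \<in> A" "K x = P h"
      using K_ex[OF rdomI[OF f]] by blast
    have "- (h - K x) \<in> M"
      using P(2)[of h] h(2) cvec.subspace_neg[OF M(1)] by metis
    from shift[OF f this] have "(x, w - h) \<in> S"
      by (simp add: algebra_simps)
    then have "(x, (w - h) + h) \<in> rsum S A"
      using h(1) unfolding rsum_def by blast
    then show "(x, w) \<in> rsum S A"
      by simp
  qed
  then have "rsum S A = perturbed"
    by (auto simp: perturbed_mem)
  with pert show ?thesis
    using that by blast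
qed

theorem theorem5p3:
  fixes S A :: "('a::chilbert \<times> 'a) set"
  assumes "lin_rel S" and "self_adjoint S"
    and "lin_rel A" and "closed A" and "hermitian A"
    and "closed (rsum S A)" and "hermitian (rsum S A)"
    and "rdom S \<subseteq> rdom A"
    and "rel_compact (rcomp_map (cproj (orth (rapp S 0))) (rel_s A)) (rel_s S)"
  shows "ess_spectrum S = ess_spectrum (rsum S A)
    \<and> (ess_spectrum S = {} \<longleftrightarrow> ess_spectrum (rsum S A) = {})"
proof -
  obtain K where "rel_compact_perturbation S K"
    and "rsum S A = rel_compact_perturbation.perturbed S K"
    using perturbation_by_relation[OF assms(1,2,3,5,8,9)] .
  then have "ess_spectrum (rsum S A) = ess_spectrum S"
    using rel_compact_perturbation.ess_spectrum_perturbed by simp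
  then show ?thesis
    by simp
qed

end
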